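(* Let $k$ be a perfect field of characteristic $p>0$, let $K=k((t))$, and let $L/K$ be a near one-dimensional elementary abelian extension of degree $q=p^{n+1}$ (for some $n\ge 0$), defined via an element $\beta\in K$ with $v_K(\beta)=-b<0$, $\gcd(b,p)=1$, as described in the context. Let $r(b)$ denote the least non-negative residue of $b$ modulo $q$. Then the valuation ring $\mathfrak{O}_L$ is free over its associated order $\mathfrak{A}_{L/K}$ if and only if $r(b)\in\mathcal{S}(q)$.
   Context: For a finite extension $L$ of $K$, $\mathfrak{O}_L$ is its valuation ring and $v_L$ its normalized valuation ($v_L(L^\times)=\mathbb{Z}$); $\mathfrak{P}_K$ is the maximal ideal of $\mathfrak{O}_K$. For $L/K$ Galois with group $G$, the associated order is $\mathfrak{A}_{L/K}=\{\alpha\in K[G]:\alpha\mathfrak{O}_L\subseteq\mathfrak{O}_L\}$. An elementary abelian extension $L=K(x_0,\dots,x_n)$ of $K$ of degree $q=p^{n+1}$ is a near one-dimensional elementary abelian extension if $x_i^p-x_i=\Omega_i^{p^n}\beta+\epsilon_i$ for $0\le i\le n$, where: $\beta\in K$ with $v_K(\beta)=-b<0$ and $\gcd(b,p)=1$; $\Omega_0=1,\Omega_1,\dots,\Omega_n\in K$ satisfy $v_K(\Omega_n)\le\cdots\le v_K(\Omega_1)\le v_K(\Omega_0)=0$, and whenever $v_K(\Omega_i)=\cdots=v_K(\Omega_j)$ for $i<j$, the images of $\Omega_i,\dots,\Omega_j$ in $\Omega_i\mathfrak{O}_K/\Omega_i\mathfrak{P}_K$ are linearly independent over $\mathbb{F}_p$;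 and $\epsilon_i\in K$ satisfy $v_K(\epsilon_i)>v_K(\Omega_i^{p^n}\beta)+\frac{(p^n-1)b}{p^n}-(p-1)\sum_{j=1}^{n-1}p^j v_K(\Omega_j)$. For an integer $j\ge0$ write $j=\sum_{s\ge0} j_{(s)}p^s$ with $0\le j_{(s)}<p$ (base-$p$ digits). For $c\in\mathbb{Z}$ with $\gcd(c,p)=1$ let $h=h_c$ be the unique integer with $hc\equiv-1\pmod q$ and $1\le h\le q-1$. The set $\mathcal{S}(q)$ consists of all integers $c$ with $\gcd(c,p)=1$ and $1\le c\le q-1$ such that for all integers $u,v\ge1$ with $u+v<c$ there exists $s\in\{0,\dots,n\}$ with $(hu)_{(s)}+(hv)_{(s)}<p-1$. *)

theory Defs
  imports Complex_Main "HOL-Computational_Algebra.Formal_Laurent_Series"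
begin

text \<open>
  The field \<open>K = k((t))\<close> is the type \<open>'k fls\<close>. Its normalized valuation at nonzero
  arguments is \<^const>\<open>fls_subdegree\<close>; the library sets \<open>fls_subdegree 0 = 0\<close>, so \<open>0\<close> is
  always treated separately below. An extension \<open>L/K\<close> is a field type \<open>'l\<close> with an
  embedding \<open>\<iota>\<close> of \<open>K\<close>.
\<close>

definition field_hom :: "('a::field \<Rightarrow> 'b::field) \<Rightarrow> bool" where
  "field_hom f \<longleftrightarrow> f 1 = 1 \<and> (\<forall>x y. f (x + y) = f x + f y) \<and> (\<forall>x y. f (x * y) = f x * f y)"

definition is_subfield :: "'a::field set \<Rightarrow> bool" where
  "is_subfield F \<longleftrightarrow> 0 \<in> F \<and> 1 \<in> F \<and> (\<forall>x\<in>F. \<forall>y\<in>F. x - y \<in> F \<and> x * y \<in> F) \<and>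
     (\<forall>x\<in>F. inverse x \<in> F)"

text \<open>\<^const>\<open>vector_space.dim\<close> is \<open>0\<close> for infinite-dimensional spaces.\<close>

definition ext_degree :: "('a::field \<Rightarrow> 'l::field) \<Rightarrow> nat" where
  "ext_degree \<iota> = vector_space.dim (\<lambda>c y. \<iota> c * y) UNIV"

definition galois_group :: "('a::field \<Rightarrow> 'l::field) \<Rightarrow> ('l \<Rightarrow> 'l) set" where
  "galois_group \<iota> = {\<sigma>. bij \<sigma> \<and> field_hom \<sigma> \<and> (\<forall>c. \<sigma> (\<iota> c) = \<iota> c)}"

definition finite_galois_ext :: "('a::field \<Rightarrow> 'l::field) \<Rightarrow> bool" where
  "finite_galois_ext \<iota> \<longleftrightarrow>
     ext_degree \<iota> > 0 \<and> {y. \<forall>\<sigma>\<in>galois_group \<iota>. \<sigma> y = y} = range \<iota>"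

definition elementary_abelian_ext :: "nat \<Rightarrow> ('a::field \<Rightarrow> 'l::field) \<Rightarrow> bool" where
  "elementary_abelian_ext p \<iota> \<longleftrightarrow>
     finite_galois_ext \<iota> \<and>
     (\<forall>\<sigma>\<in>galois_group \<iota>. \<forall>\<tau>\<in>galois_group \<iota>. \<sigma> \<circ> \<tau> = \<tau> \<circ> \<sigma>) \<and>
     (\<forall>\<sigma>\<in>galois_group \<iota>. \<sigma> ^^ p = id)"

text \<open>
  The normalized valuation of a finite extension \<open>L\<close> of \<open>K\<close>; as \<open>K\<close> is complete, exactly
  one function on \<open>L - {0}\<close> has these properties. The value at \<open>0\<close> is irrelevant.
\<close>

definition normalized_valuation :: "('k::field fls \<Rightarrow> 'l::field) \<Rightarrow> ('l \<Rightarrow> int) \<Rightarrow> bool" where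
  "normalized_valuation \<iota> v \<longleftrightarrow>
     v ` (UNIV - {0}) = UNIV \<and>
     (\<forall>x y. x \<noteq> 0 \<longrightarrow> y \<noteq> 0 \<longrightarrow> v (x * y) = v x + v y) \<and>
     (\<forall>x y. x \<noteq> 0 \<longrightarrow> y \<noteq> 0 \<longrightarrow> x + y \<noteq> 0 \<longrightarrow> v (x + y) \<ge> min (v x) (v y)) \<and>
     (\<exists>e>0. \<forall>z. z \<noteq> 0 \<longrightarrow> v (\<iota> z) = e * fls_subdegree z)"

definition valuation_ring :: "('l::field \<Rightarrow> int) \<Rightarrow> 'l set" where
  "valuation_ring v = {y. y = 0 \<or> v y \<ge> 0}"

definition maximal_ideal :: "('l::field \<Rightarrow> int) \<Rightarrow> 'l set" where
  "maximal_ideal v = {y. y = 0 \<or> v y > 0}"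

text \<open>
  An element \<open>\<Sum>\<^sub>\<sigma> \<alpha>\<^sub>\<sigma> \<sigma>\<close> of the group algebra \<open>K[G]\<close> is the function \<open>\<sigma> \<mapsto> \<alpha>\<^sub>\<sigma>\<close>, extended
  by \<open>0\<close> to all functions \<open>L \<Rightarrow> L\<close> outside \<open>G\<close>. It acts on \<open>L\<close> by
  \<open>\<alpha> y = \<Sum>\<^sub>\<sigma> \<alpha>\<^sub>\<sigma> \<sigma>(y)\<close>.
\<close>

definition group_algebra :: "('a::field \<Rightarrow> 'l::field) \<Rightarrow> (('l \<Rightarrow> 'l) \<Rightarrow> 'a) set" where
  "group_algebra \<iota> = {\<alpha>. \<forall>\<sigma>. \<sigma> \<notin> galois_group \<iota> \<longrightarrow> \<alpha> \<sigma> = 0}"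

definition group_algebra_act ::
    "('a::field \<Rightarrow> 'l::field) \<Rightarrow> (('l \<Rightarrow> 'l) \<Rightarrow> 'a) \<Rightarrow> 'l \<Rightarrow> 'l" where
  "group_algebra_act \<iota> \<alpha> y = (\<Sum>\<sigma>\<in>galois_group \<iota>. \<iota> (\<alpha> \<sigma>) * \<sigma> y)"

definition associated_order ::
    "('a::field \<Rightarrow> 'l::field) \<Rightarrow> ('l \<Rightarrow> int) \<Rightarrow> (('l \<Rightarrow> 'l) \<Rightarrow> 'a) set" where
  "associated_order \<iota> v =
     {\<alpha> \<in> group_algebra \<iota>. group_algebra_act \<iota> \<alpha> ` valuation_ring v \<subseteq> valuation_ring v}"

text \<open>
  \<open>M\<close> is free over \<open>A\<close> (with zero element \<open>z\<close>, acting by \<open>act\<close>) iff it has a basis: a subset \<open>B\<close>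
  such that each element of \<open>M\<close> is in a unique way a finitely supported \<open>A\<close>-linear combination
  of \<open>B\<close>. Only the zero and the action of \<open>A\<close> enter; its multiplication does not.
\<close>

definition is_free_module ::
    "'r set \<Rightarrow> 'r \<Rightarrow> ('r \<Rightarrow> 'm \<Rightarrow> 'm) \<Rightarrow> 'm::comm_monoid_add set \<Rightarrow> bool" where
  "is_free_module A z act M \<longleftrightarrow>
     (\<exists>B\<subseteq>M. \<forall>y\<in>M. \<exists>!c. (\<forall>w\<in>B. c w \<in> A) \<and> (\<forall>w. w \<notin> B \<longrightarrow> c w = z) \<and>
        finite {w. c w \<noteq> z} \<and> y = (\<Sum>w | c w \<noteq> z. act (c w) w))"

definition free_over_associated_order ::
    "('a::field \<Rightarrow> 'l::field) \<Rightarrow> ('l \<Rightarrow> int) \<Rightarrow> bool" where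
  "free_over_associated_order \<iota> v \<longleftrightarrow>
     is_free_module (associated_order \<iota> v) (\<lambda>_. 0) (group_algebra_act \<iota>) (valuation_ring v)"

text \<open>
  The condition on the \<open>\<Omega>\<^sub>s\<close> with \<open>i \<le> s \<le> j\<close> and equal valuations says that their images in
  \<open>\<Omega>\<^sub>i O\<^sub>K / \<Omega>\<^sub>i P\<^sub>K\<close> are linearly independent over \<open>F\<^sub>p\<close>; coefficients in \<open>F\<^sub>p\<close> are represented
  by integers. If \<open>\<epsilon>\<^sub>i = 0\<close>, its valuation is \<open>\<infinity>\<close> and the bound holds trivially.
\<close>

definition near_one_dim_ext ::
    "nat \<Rightarrow> nat \<Rightarrow> ('k::field fls \<Rightarrow> 'l::field) \<Rightarrow> 'k fls \<Rightarrow> nat \<Rightarrow>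
     (nat \<Rightarrow> 'k fls) \<Rightarrow> (nat \<Rightarrow> 'k fls) \<Rightarrow> (nat \<Rightarrow> 'l) \<Rightarrow> bool" where
  "near_one_dim_ext p n \<iota> \<beta> b \<Omega> \<epsilon> x \<longleftrightarrow>
     elementary_abelian_ext p \<iota> \<and>
     ext_degree \<iota> = p ^ (n + 1) \<and>
     is_subfield hull (range \<iota> \<union> x ` {0..n}) = UNIV \<and>
     (\<forall>i\<le>n. x i ^ p - x i = \<iota> (\<Omega> i ^ (p ^ n) * \<beta> + \<epsilon> i)) \<and>
     fls_subdegree \<beta> = - int b \<and> b > 0 \<and> coprime b p \<and>
     \<Omega> 0 = 1 \<and>
     (\<forall>i\<le>n. \<Omega> i \<noteq> 0) \<and>
     (\<forall>i<n. fls_subdegree (\<Omega> (Suc i)) \<le> fls_subdegree (\<Omega> i)) \<and>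
     (\<forall>i j. i < j \<longrightarrow> j \<le> n \<longrightarrow>
        (\<forall>s\<in>{i..j}. fls_subdegree (\<Omega> s) = fls_subdegree (\<Omega> i)) \<longrightarrow>
        (\<forall>a :: nat \<Rightarrow> int.
           (\<Sum>s=i..j. of_int (a s) * \<Omega> s) \<in> (\<lambda>z. \<Omega> i * z) ` maximal_ideal fls_subdegree \<longrightarrow>
           (\<forall>s\<in>{i..j}. int p dvd a s))) \<and>
     (\<forall>i\<le>n. \<epsilon> i \<noteq> 0 \<longrightarrow>
        real_of_int (fls_subdegree (\<epsilon> i)) >
          real_of_int (fls_subdegree (\<Omega> i ^ (p ^ n) * \<beta>))
          + (real p ^ n - 1) * real b / real p ^ n
          - (real p - 1) * (\<Sum>j=1..<n. real p ^ j * real_of_int (fls_subdegree (\<Omega> j))))"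

definition base_digit :: "nat \<Rightarrow> nat \<Rightarrow> nat \<Rightarrow> nat" where
  "base_digit p j s = (j div p ^ s) mod p"

text \<open>\<open>h c \<equiv> -1 (mod q)\<close> is written as \<open>q\<close> dividing \<open>h c + 1\<close>.\<close>

definition h_inv :: "nat \<Rightarrow> nat \<Rightarrow> nat" where
  "h_inv q c = (THE h. 1 \<le> h \<and> h \<le> q - 1 \<and> q dvd h * c + 1)"

text \<open>The set \<open>S(q)\<close> for \<open>q = p\<^sup>n\<^sup>+\<^sup>1\<close>.\<close>

definition S_set :: "nat \<Rightarrow> nat \<Rightarrow> nat set" where
  "S_set p n = (let q = p ^ (n + 1) in
     {c. coprime c p \<and> 1 \<le> c \<and> c \<le> q - 1 \<and>
         (\<forall>u v. 1 \<le> u \<longrightarrow> 1 \<le> v \<longrightarrow> u + v < c \<longrightarrow>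
           (\<exists>s\<in>{0..n}. base_digit p (h_inv q c * u) s + base_digit p (h_inv q c * v) s < p - 1))})"

end

theory Submission
  imports Defs "HOL-Number_Theory.Cong"
begin

text \<open>
  Let \<open>D\<^sub>i\<^sub>j\<close> be the value at \<open>\<Omega>\<^sub>j\<close> of the monic additive polynomial with root space
  \<open>\<F>\<^sub>p\<Omega>\<^sub>0 + \<dots> + \<F>\<^sub>p\<Omega>\<^sub>i\<^sub>-\<^sub>1\<close>. Eliminating \<open>x\<^sub>0, \<dots>, x\<^sub>i\<^sub>-\<^sub>1\<close> from the Artin--Schreier equations with the
  help of the \<open>D\<^sub>i\<^sub>j\<close> gives \<open>X\<^sub>i \<in> x\<^sub>i + K x\<^sub>i\<^sub>-\<^sub>1 + \<dots> + K x\<^sub>0\<close> with \<open>v\<^sub>L(X\<^sub>i) = -p\<^sup>n\<^sup>-\<^sup>i b\<^sub>(\<^sub>i\<^sub>)\<close>, where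
  \<open>b\<^sub>(\<^sub>i\<^sub>) \<equiv> b\<close> modulo \<open>q\<close>. The products \<open>e\<^sub>j\<close> of divided powers of the \<open>X\<^sub>i\<close>, with exponents the
  base-\<open>p\<close> digits of \<open>j < q\<close>, have valuations \<open>\<equiv> -bj\<close> modulo \<open>q\<close> and hence form a \<open>K\<close>-basis of \<open>L\<close>
  compatible with the valuation. Since \<open>\<sigma> X\<^sub>i - X\<^sub>i \<in> K\<close>, the algebra \<open>K[G]\<close> acts by combinations of the
  shifts \<open>e\<^sub>j \<mapsto> e\<^sub>j\<^sub>-\<^sub>a\<close> (zero unless \<open>a\<close> is digitwise at most \<open>j\<close>), and by a dimension count all
  such combinations occur. So the associated order has an \<open>O\<^sub>K\<close>-basis of multiples of shifts, and freeness
  becomes a triangular problem whose solution is an inequality between the numbers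
  \<open>\<lceil>r(b) j / q\<rceil>\<close>; this inequality is the condition defining \<open>S(q)\<close>.
\<close>

section \<open>Digits and the set \<open>S(q)\<close>\<close>

text \<open>For prime p and q = p^(n+1) this says that a + i < q and p does not divide the binomial
  coefficient of a + i over a (Kummer).\<close>

definition nocarry :: "nat \<Rightarrow> nat \<Rightarrow> nat \<Rightarrow> nat \<Rightarrow> bool" where
  "nocarry p n a i \<longleftrightarrow> a < p ^ (n + 1) \<and> i < p ^ (n + 1) \<and>
     (\<forall>s\<le>n. base_digit p a s + base_digit p i s < p)"

lemma base_digit_less: "p > 0 \<Longrightarrow> base_digit p j s < p"
  by (simp add: base_digit_def)

lemma mod_eq_digit_sum: "j mod p ^ m = (\<Sum>s<m. base_digit p j s * p ^ s)"
proof (induction m)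
  case (Suc m)
  have "j mod p ^ Suc m = p ^ m * (j div p ^ m mod p) + j mod p ^ m"
    using mod_mult2_eq[of j "p ^ m" p] by (simp add: mult.commute)
  then show ?case using Suc by (simp add: base_digit_def)
qed auto

lemma digit_sum:
  assumes "p > 0" "\<And>s. s < m \<Longrightarrow> f s < p"
  shows digit_sum_less: "(\<Sum>s<m. f s * p ^ s) < p ^ m"
    and base_digit_sum: "t < m \<Longrightarrow> base_digit p (\<Sum>s<m. f s * p ^ s) t = f t"
proof -
  \<comment> \<open>Both conclusions go through one induction: finding the top digit needs the bound
    on the lower part.\<close>
  have "(\<Sum>s<m. f s * p ^ s) < p ^ m \<and> (\<forall>t<m. base_digit p (\<Sum>s<m. f s * p ^ s) t = f t)"
    using assms(2)
  proof (induction m)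
    case (Suc m)
    define A where "A = (\<Sum>s<m. f s * p ^ s)"
    have A: "A < p ^ m" and dA: "\<And>t. t < m \<Longrightarrow> base_digit p A t = f t"
      using Suc unfolding A_def by auto
    have "Suc (f m) * p ^ m \<le> p * p ^ m" using Suc.prems[of m] by (intro mult_right_mono) auto
    then have less: "A + f m * p ^ m < p ^ Suc m" using A by simp
    have "base_digit p (A + f m * p ^ m) t = f t" if "t < Suc m" for t
    proof (cases "t = m")
      case True
      then show ?thesis using A Suc.prems[of m] assms(1) by (simp add: base_digit_def)
    next
      case False
      then have t: "t < m" using that by simp
      \<comment> \<open>Since t < m, the new top term is a multiple of p^(t+1), so adding it leaves
        digit t unchanged.\<close>
      then have "f m * p ^ m = (p * (f m * p ^ (m - t - 1))) * p ^ t"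
        using power_add[of p t "Suc (m - t - 1)"] by (simp add: ac_simps)
      then have "(A + f m * p ^ m) div p ^ t = A div p ^ t + p * (f m * p ^ (m - t - 1))"
        using assms(1) by (simp only: div_mult_self1 power_not_zero neq0_conv) (simp add: div_mult_self1 add.commute)
      then show ?thesis using dA[OF t] by (simp add: base_digit_def)
    qed
    then show ?case using less by (simp add: A_def)
  qed auto
  then show "(\<Sum>s<m. f s * p ^ s) < p ^ m"
    and "t < m \<Longrightarrow> base_digit p (\<Sum>s<m. f s * p ^ s) t = f t" by auto
qed

lemma base_digit_mod:
  assumes "p > 0" "t < m"
  shows "base_digit p (j mod p ^ m) t = base_digit p j t"
  unfolding mod_eq_digit_sum using assms base_digit_less by (intro base_digit_sum) auto

lemma digit_expansion: "j < p ^ m \<Longrightarrow> j = (\<Sum>s<m. base_digit p j s * p ^ s)"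
  using mod_eq_digit_sum[of j p m] by simp

lemma digit_eqI:
  assumes "a < p ^ m" "i < p ^ m" "\<And>s. s < m \<Longrightarrow> base_digit p a s = base_digit p i s"
  shows "a = i"
  using digit_expansion[OF assms(1)] digit_expansion[OF assms(2)] assms(3) by simp

lemma nocarry_commute: "nocarry p n a i \<longleftrightarrow> nocarry p n i a"
  by (auto simp: nocarry_def add.commute)

context
  fixes p n :: nat
  assumes p: "p > 0"
begin

lemma nocarry_0: "i < p ^ (n + 1) \<Longrightarrow> nocarry p n 0 i"
  using p by (auto simp: nocarry_def base_digit_def)

lemma nocarry_add:
  assumes "nocarry p n a i"
  shows nocarry_add_less: "a + i < p ^ (n + 1)"
    and nocarry_add_digit: "s \<le> n \<Longrightarrow> base_digit p (a + i) s = base_digit p a s + base_digit p i s"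
proof -
  have *: "a + i = (\<Sum>s<n+1. (base_digit p a s + base_digit p i s) * p ^ s)"
    using digit_expansion[of a p "n+1"] digit_expansion[of i p "n+1"] assms
    unfolding nocarry_def by (simp add: sum.distrib algebra_simps)
  have **: "\<And>s. s < n + 1 \<Longrightarrow> base_digit p a s + base_digit p i s < p"
    using assms by (auto simp: nocarry_def)
  show "a + i < p ^ (n + 1)" unfolding * by (intro digit_sum_less p **)
  show "base_digit p (a + i) s = base_digit p a s + base_digit p i s" if "s \<le> n"
    unfolding * using base_digit_sum[of p "n+1" "\<lambda>s. base_digit p a s + base_digit p i s" s] p ** that by simp
qed

text \<open>All digits of \<open>p ^ (n + 1) - 1\<close> equal p - 1, so subtracting i never
  borrows.\<close>

lemma complement_digit:
  assumes "i < p ^ (n + 1)" "s \<le> n"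
  shows "base_digit p (p ^ (n + 1) - 1 - i) s = p - 1 - base_digit p i s"
proof -
  have le: "base_digit p i s \<le> p - 1" for s using base_digit_less[OF p, of i s] by simp
  have "(\<Sum>s<m. (p - 1) * p ^ s) = p ^ m - 1" for m
    using p by (induction m) (auto simp: algebra_simps)
  then have "p ^ (n + 1) - 1 = (\<Sum>s<n+1. (p - 1) * p ^ s)" by simp
  also have "\<dots> = (\<Sum>s<n+1. (p - 1 - base_digit p i s) * p ^ s + base_digit p i s * p ^ s)"
    using le by (intro sum.cong refl) (simp only: add_mult_distrib[symmetric] le_add_diff_inverse2)
  also have "\<dots> = (\<Sum>s<n+1. (p - 1 - base_digit p i s) * p ^ s) + i"
    using digit_expansion[OF assms(1)] by (simp only: sum.distrib)
  finally have *: "p ^ (n + 1) - 1 - i = (\<Sum>s<n+1. (p - 1 - base_digit p i s) * p ^ s)"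
    by (simp only: diff_add_inverse2)
  have **: "\<And>s. s < n + 1 \<Longrightarrow> p - 1 - base_digit p i s < p" using p by auto
  show ?thesis unfolding * using base_digit_sum[of p "n+1" "\<lambda>s. p - 1 - base_digit p i s" s] p ** assms(2) by simp
qed

lemma nocarry_complement: "i < p ^ (n + 1) \<Longrightarrow> nocarry p n (p ^ (n + 1) - 1 - i) i"
proof -
  assume i: "i < p ^ (n + 1)"
  have "base_digit p (p ^ (n + 1) - 1 - i) s + base_digit p i s < p" if "s \<le> n" for s
    using complement_digit[OF i that] base_digit_less[OF p, of i s] by linarith
  then show ?thesis using i p unfolding nocarry_def by auto
qed

text \<open>Digit s of the complement of a + i is p - 1 - a_s - i_s, and adding a_s gives at most p
  - 1. This serves as a change of variables in \<open>ceiling_condition_iff_S_set\<close>.\<close>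

lemma nocarry_reflect:
  assumes "nocarry p n a i"
  shows "nocarry p n a (p ^ (n + 1) - 1 - (a + i))"
proof -
  have "base_digit p a s + base_digit p (p ^ (n + 1) - 1 - (a + i)) s < p" if "s \<le> n" for s
    using complement_digit[OF nocarry_add_less[OF assms] that] nocarry_add_digit[OF assms that]
      assms that unfolding nocarry_def by auto
  then show ?thesis using assms p by (auto simp: nocarry_def)
qed

text \<open>If a is digitwise at most i, the subtraction never borrows, so the digits of i - a are
  the differences of digits.\<close>

lemma nocarry_diff:
  assumes "a < p ^ (n + 1)" "i < p ^ (n + 1)" "\<And>s. s \<le> n \<Longrightarrow> base_digit p a s \<le> base_digit p i s"
  shows "a \<le> i" "nocarry p n a (i - a)"
proof -
  have "(\<Sum>s<n+1. base_digit p a s * p ^ s) \<le> (\<Sum>s<n+1. base_digit p i s * p ^ s)"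
    using assms(3) by (intro sum_mono mult_right_mono) auto
  then have le: "a \<le> i"
    by (simp only: digit_expansion[OF assms(1), symmetric] digit_expansion[OF assms(2), symmetric])
  have *: "i - a = (\<Sum>s<n+1. (base_digit p i s - base_digit p a s) * p ^ s)"
  proof -
    have "i = (\<Sum>s<n+1. (base_digit p i s - base_digit p a s) * p ^ s + base_digit p a s * p ^ s)"
      by (subst digit_expansion[OF assms(2)], intro sum.cong refl)
        (use assms(3) in \<open>simp flip: add_mult_distrib\<close>)
    also have "\<dots> = (\<Sum>s<n+1. (base_digit p i s - base_digit p a s) * p ^ s) + a"
      using digit_expansion[OF assms(1)] by (simp only: sum.distrib)
    finally show ?thesis by (metis diff_add_inverse2)
  qed
  have lt: "\<And>s. s < n + 1 \<Longrightarrow> base_digit p i s - base_digit p a s < p"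
    using base_digit_less[OF p] by (meson le_less_trans diff_le_self)
  have "base_digit p (i - a) s = base_digit p i s - base_digit p a s" if "s \<le> n" for s
    unfolding * using base_digit_sum[of p "n+1" "\<lambda>s. base_digit p i s - base_digit p a s" s] p lt that by simp
  then have "base_digit p a s + base_digit p (i - a) s < p" if "s \<le> n" for s
    using that assms(3)[OF that] base_digit_less[OF p, of i s] by simp
  then show "nocarry p n a (i - a)" using assms by (auto simp: nocarry_def)
  show "a \<le> i" by (fact le)
qed

end

text \<open>The definite description in \<open>h_inv\<close> is meaningful: the negative of an
  inverse of c exists modulo q, and cancelling c gives uniqueness.\<close>

lemma h_inv_dvd:
  assumes "coprime c q" "q > 1"
  shows "q dvd h_inv q c * c + 1"
proof -
  obtain x where x: "[c * x = 1] (mod q)" using cong_solve_coprime_nat[OF assms(1)] by auto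
  \<comment> \<open>Over the natural numbers \<open>q - 1\<close> plays the role of -1 modulo
    q.\<close>
  define h where "h = (q - 1) * x mod q"
  have "[h * c + 1 = ((q - 1) * x) * c + 1] (mod q)" unfolding h_def
    by (intro cong_add cong_mult cong_refl) simp
  also have "((q - 1) * x) * c + 1 = (q - 1) * (c * x) + 1" by (simp add: ac_simps)
  also have "[(q - 1) * (c * x) + 1 = (q - 1) * 1 + 1] (mod q)"
    by (intro cong_add cong_mult x cong_refl)
  also have "(q - 1) * 1 + 1 = q" using assms by simp
  finally have dvd: "q dvd h * c + 1" by (simp add: cong_def dvd_eq_mod_eq_0)
  have "h \<noteq> 0" using dvd assms(2) by (metis add_0 mult_0 nat_dvd_1_iff_1 less_irrefl)
  moreover have "h < q" unfolding h_def using assms(2) by simp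
  ultimately have h1: "1 \<le> h \<and> h \<le> q - 1 \<and> q dvd h * c + 1"
    using dvd by linarith
  have "h' = h" if "1 \<le> h' \<and> h' \<le> q - 1 \<and> q dvd h' * c + 1" for h'
  proof -
    have "[h' * c + 1 = h * c + 1] (mod q)" using that h1
      by (metis cong_0_iff cong_sym cong_trans)
    then have "[h' * c = h * c] (mod q)" by (simp only: cong_add_rcancel_nat)
    then have "[h' = h] (mod q)" using assms(1) by (simp add: cong_mult_rcancel_nat)
    moreover have "h' < q" "h < q" using that h1 assms(2) by linarith+
    ultimately show ?thesis by (rule cong_less_modulus_unique_nat)
  qed
  then have "1 \<le> h_inv q c \<and> h_inv q c \<le> q - 1 \<and> q dvd h_inv q c * c + 1"
    unfolding h_inv_def by (rule theI[where P = "\<lambda>h. 1 \<le> h \<and> h \<le> q - 1 \<and> q dvd h * c + 1", OF h1])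
  then show ?thesis by blast
qed

text \<open>With \<open>f i = r (1 + i) mod q\<close>, the left-hand side says that \<open>f a + f i \<ge> r\<close> whenever \<open>a + i\<close>
  has no carry, and \<open>a\<close> is recovered from \<open>u = f a\<close> as the digitwise complement of \<open>h u mod q\<close>.\<close>

lemma ceiling_condition_iff_S_set:
  fixes p n r :: nat
  defines "q \<equiv> p ^ (n + 1)"
  defines "D \<equiv> \<lambda>j::nat. - ((- (int r * int j)) div int q)"
  assumes p: "p > 1" and r: "coprime r p" "1 \<le> r" "r < q"
  shows "(\<forall>a i. nocarry p n a i \<longrightarrow> D (q - 1) - D (q - 1 - a) \<le> D (a + i) - D i) \<longleftrightarrow> r \<in> S_set p n"
proof -
  have p0: "p > 0" using p by simp
  have q: "q > 1" unfolding q_def using p by (intro one_less_power) auto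
  define f where "f = (\<lambda>i. r * (1 + i) mod q)"
  \<comment> \<open>\<open>D j\<close> is the ceiling of r j / q. As r (q - 1 - i) is congruent to -
    r (1 + i), the residue \<open>f i\<close> is what must be added to r (q - 1 - i) to reach the
    next multiple of q.\<close>
  have D: "int q * D (q - 1 - i) = int r * int (q - 1 - i) + int (f i)" if "i < q" for i
  proof -
    have "int (f i) = (int r * (1 + int i)) mod int q" by (simp add: f_def of_nat_mod algebra_simps)
    also have "\<dots> = (- (int r * int (q - 1 - i)) + int q * int r) mod int q"
      using that by (simp add: of_nat_diff algebra_simps)
    also have "\<dots> = (- (int r * int (q - 1 - i))) mod int q" by (rule mod_mult_self2)
    finally have "int q * ((- (int r * int (q - 1 - i))) div int q) + int (f i) = - (int r * int (q - 1 - i))"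
      by (simp only: mult_div_mod_eq)
    then show ?thesis unfolding D_def by (simp only: mult_minus_right)
  qed
  have f0: "f 0 = r" using r by (simp add: f_def)
  \<comment> \<open>After multiplication by q the terms linear in r cancel, and
    \<open>f 0 = r\<close> remains.\<close>
  have step: "D (q - 1) - D (q - 1 - a) \<le> D (q - 1 - i) - D (q - 1 - (a + i)) \<longleftrightarrow> f (a + i) + r \<le> f a + f i"
    if "nocarry p n a i" for a i
  proof -
    have l: "a + i < q" using nocarry_add_less[OF p0 that] by (simp add: q_def)
    have "D (q - 1) - D (q - 1 - a) \<le> D (q - 1 - i) - D (q - 1 - (a + i)) \<longleftrightarrow>
       int q * (D (q - 1) - D (q - 1 - a)) \<le> int q * (D (q - 1 - i) - D (q - 1 - (a + i)))"
      using q by simp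
    also have "\<dots> \<longleftrightarrow> int (f (a + i) + r) \<le> int (f a + f i)"
    proof -
      have D': "int q * D (q - 1 - j) = int r * int (q - 1) - int r * int j + int (f j)" if "j < q" for j
        using D[OF that] that by (simp add: of_nat_diff right_diff_distrib distrib_left)
      have "a < q" "i < q" "0 < q" using l by simp_all
      then show ?thesis
        using D'[of 0] D'[of a] D'[of i] D'[OF l]
        by (simp only: right_diff_distrib of_nat_add distrib_left f0 diff_zero of_nat_0 mult_zero_right) (simp, linarith)
    qed
    finally show ?thesis by (simp only: of_nat_le_iff)
  qed
  \<comment> \<open>Both sides of the first inequality are congruent modulo q. As
    \<open>f (a + i)\<close> is a least residue, it cannot exceed f a + f i - r once that difference
    is nonnegative.\<close>
  have cond: "f (a + i) + r \<le> f a + f i \<longleftrightarrow> r \<le> f a + f i" for a i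
  proof
    assume *: "r \<le> f a + f i"
    have "[f (a + i) + r = r * (1 + (a + i)) + r] (mod q)"
      unfolding f_def by (intro cong_add) (auto simp: cong_def)
    also have "r * (1 + (a + i)) + r = r * (1 + a) + r * (1 + i)" by (simp add: algebra_simps)
    also have "[r * (1 + a) + r * (1 + i) = f a + f i] (mod q)"
      unfolding f_def by (intro cong_add) (auto simp: cong_def)
    finally have c: "[f (a + i) + r = f a + f i] (mod q)" .
    then have c2: "[f (a + i) = f a + f i - r] (mod q)"
      using * by (metis cong_add_rcancel_nat le_add_diff_inverse2)
    have "f (a + i) \<le> f a + f i - r"
    proof -
      have "f (a + i) = (f a + f i - r) mod q"
        using c2 unfolding cong_def f_def by simp
      then show ?thesis by simp
    qed
    then show "f (a + i) + r \<le> f a + f i" using * by simp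
  qed simp
  define h where "h = h_inv q r"
  have cq: "coprime r q" using r by (simp add: q_def)
  have h: "q dvd h * r + 1" unfolding h_def using h_inv_dvd cq q by blast
  \<comment> \<open>h is -1/r modulo q, so it sends r (1 + a) to -(1 + a), whose residue is the
    digitwise complement of a.\<close>
  have hf: "h * f a mod q = q - 1 - a" if "a < q" for a
  proof -
    have "[h * f a + (1 + a) = h * (r * (1 + a)) + (1 + a)] (mod q)"
      unfolding f_def by (intro cong_add cong_mult) (auto simp: cong_def)
    also have "h * (r * (1 + a)) + (1 + a) = (h * r + 1) * (1 + a)" by (simp add: algebra_simps)
    also have "[(h * r + 1) * (1 + a) = q - 1 - a + (1 + a)] (mod q)"
    proof -
      have "q dvd (h * r + 1) * (1 + a)" using h by (rule dvd_mult2)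
      moreover have "q - 1 - a + (1 + a) = q" using that by simp
      ultimately show ?thesis unfolding cong_def by (metis dvd_imp_mod_0 mod_self)
    qed
    finally have "[h * f a = q - 1 - a] (mod q)" by (simp only: cong_add_rcancel_nat)
    then show ?thesis using that unfolding cong_def by simp
  qed
  have digit: "base_digit p a s = p - 1 - base_digit p (h * f a) s" if "a < q" "s \<le> n" for a s
  proof -
    have "base_digit p (h * f a) s = base_digit p (q - 1 - a) s"
      using hf[OF that(1)] base_digit_mod[OF p0, of s "n+1" "h * f a"] that(2) by (simp add: q_def)
    also have "\<dots> = p - 1 - base_digit p a s"
      using complement_digit[OF p0, of a n s] that by (simp add: q_def)
    finally show ?thesis using base_digit_less[OF p0, of a s] by simp
  qed
  have nc: "nocarry p n a i \<longleftrightarrow> \<not> (\<exists>s\<in>{0..n}. base_digit p (h * f a) s + base_digit p (h * f i) s < p - 1)"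
    if "a < q" "i < q" for a i
  proof -
    have "base_digit p a s + base_digit p i s < p \<longleftrightarrow>
      \<not> base_digit p (h * f a) s + base_digit p (h * f i) s < p - 1" if s: "s \<le> n" for s
      using digit[OF \<open>a < q\<close> s] digit[OF \<open>i < q\<close> s] base_digit_less[OF p0, of "h * f a" s]
        base_digit_less[OF p0, of "h * f i" s] by linarith
    then show ?thesis using that unfolding nocarry_def q_def by auto
  qed
  have surj: "\<exists>a<q. f a = u" if "u < q" for u
  proof -
    obtain x where x: "[r * x = 1] (mod q)" using cong_solve_coprime_nat[OF cq] by auto
    \<comment> \<open>This is x u - 1 modulo q, the solution of r (1 + a) = u.\<close>
    define a where "a = (x * u + (q - 1)) mod q"
    have "[r * (1 + a) = r * (1 + (x * u + (q - 1)))] (mod q)"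
      unfolding a_def by (intro cong_mult cong_add) (auto simp: cong_def)
    also have "r * (1 + (x * u + (q - 1))) = (r * x) * u + q * r"
      using q by (simp add: algebra_simps)
    also have "[(r * x) * u + q * r = 1 * u + 0] (mod q)"
      by (intro cong_add cong_mult x) (auto simp: cong_def)
    finally have "f a = u" using that unfolding f_def cong_def by simp
    then show ?thesis using q unfolding a_def by (intro exI[of _ a]) (auto simp: a_def)
  qed
  \<comment> \<open>For fixed a, replacing i by q - 1 - (a + i) is an involution on the pairs
    without carry.\<close>
  have "(\<forall>a i. nocarry p n a i \<longrightarrow> D (q - 1) - D (q - 1 - a) \<le> D (a + i) - D i) \<longleftrightarrow>
    (\<forall>a i. nocarry p n a i \<longrightarrow> D (q - 1) - D (q - 1 - a) \<le> D (q - 1 - i) - D (q - 1 - (a + i)))"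
    (is "?L \<longleftrightarrow> ?R")
  proof safe
    fix a i assume *: "?L" "nocarry p n a i"
    have l: "a + i < q" using nocarry_add_less[OF p0 *(2)] by (simp add: q_def)
    have "nocarry p n a (q - 1 - (a + i))" using nocarry_reflect[OF p0 *(2)] by (simp add: q_def)
    then have "D (q - 1) - D (q - 1 - a) \<le> D (a + (q - 1 - (a + i))) - D (q - 1 - (a + i))"
      using *(1) by blast
    moreover have "a + (q - 1 - (a + i)) = q - 1 - i" using l by simp
    ultimately show "D (q - 1) - D (q - 1 - a) \<le> D (q - 1 - i) - D (q - 1 - (a + i))" by simp
  next
    fix a i assume *: "?R" "nocarry p n a i"
    have l: "a + i < q" using nocarry_add_less[OF p0 *(2)] by (simp add: q_def)
    define i' where "i' = q - 1 - (a + i)"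
    have "nocarry p n a i'" using nocarry_reflect[OF p0 *(2)] by (simp add: q_def i'_def)
    then have "D (q - 1) - D (q - 1 - a) \<le> D (q - 1 - i') - D (q - 1 - (a + i'))"
      using *(1) by blast
    moreover have "q - 1 - i' = a + i" "q - 1 - (a + i') = i" using l by (simp_all add: i'_def)
    ultimately show "D (q - 1) - D (q - 1 - a) \<le> D (a + i) - D i" by simp
  qed
  also have "\<dots> \<longleftrightarrow> (\<forall>a i. nocarry p n a i \<longrightarrow> r \<le> f a + f i)"
    using step cond by blast
  also have "\<dots> \<longleftrightarrow> (\<forall>u v. u < q \<longrightarrow> v < q \<longrightarrow> u + v < r \<longrightarrow>
      (\<exists>s\<in>{0..n}. base_digit p (h * u) s + base_digit p (h * v) s < p - 1))" (is "?L \<longleftrightarrow> ?R")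
  proof
    assume ?L
    show ?R
    proof (intro allI impI)
      fix u v assume uv: "u < q" "v < q" "u + v < r"
      obtain a i where ai: "a < q" "f a = u" "i < q" "f i = v" using surj uv by metis
      show "\<exists>s\<in>{0..n}. base_digit p (h * u) s + base_digit p (h * v) s < p - 1"
        using \<open>?L\<close> nc[OF ai(1,3)] ai uv by (metis not_le)
    qed
  next
    assume ?R
    show ?L
    proof (intro allI impI)
      fix a i assume ai: "nocarry p n a i"
      then have "a < q" "i < q" by (auto simp: nocarry_def q_def)
      moreover have "f a < q" "f i < q" using q by (auto simp: f_def)
      ultimately show "r \<le> f a + f i" using \<open>?R\<close> nc ai by (meson not_le)
    qed
  qed
  also have "\<dots> \<longleftrightarrow> (\<forall>u v. 1 \<le> u \<longrightarrow> 1 \<le> v \<longrightarrow> u + v < r \<longrightarrow>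
      (\<exists>s\<in>{0..n}. base_digit p (h * u) s + base_digit p (h * v) s < p - 1))" (is "?L \<longleftrightarrow> ?R")
  proof
    assume ?L then show ?R using r by auto
  next
    assume R: ?R
    \<comment> \<open>The set S(q) quantifies over positive u and v only. If one of them is 0, a
      suitable digit exists anyway: otherwise all digits of h v are p - 1, so h v is congruent to -1
      and hence to h r, and v = r contradicts v < r.\<close>
    have zero: "\<exists>s\<in>{0..n}. base_digit p (h * v) s < p - 1" if "v < r" for v
    proof (rule ccontr)
      assume neg: "\<not> ?thesis"
      have "h * v mod q = q - 1"
      proof (rule digit_eqI[where m = "n+1" and p = p, folded q_def])
        show "h * v mod q < q" "q - 1 < q" using q by simp_all
        fix s assume s: "s < n + 1"
        have "base_digit p (h * v) s = p - 1"
        proof -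
          have "\<not> base_digit p (h * v) s < p - 1" using neg s by auto
          then show ?thesis using base_digit_less[OF p0, of "h * v" s] by linarith
        qed
        moreover have "base_digit p (q - 1) s = p - 1"
          using complement_digit[OF p0, of 0 n s] s p0 by (simp add: q_def base_digit_def)
        ultimately show "base_digit p (h * v mod q) s = base_digit p (q - 1) s"
          using base_digit_mod[OF p0 s, of "h * v"] by (simp add: q_def)
      qed
      then have "h * v = h * v div q * q + (q - 1)" by (metis div_mult_mod_eq)
      then have "h * v + 1 = (h * v div q + 1) * q" using q by (metis Suc_eq_plus1 Suc_pred' add.assoc add_mult_distrib less_trans mult_1 zero_less_one)
      then have "q dvd h * v + 1" by (metis dvd_triv_right)
      then have "[h * v + 1 = h * r + 1] (mod q)" using h by (simp add: cong_def dvd_eq_mod_eq_0)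
      then have "[h * v = h * r] (mod q)" by (simp only: cong_add_rcancel_nat)
      moreover have "coprime h q"
      proof (rule coprimeI)
        fix d assume "d dvd h" "d dvd q"
        then have "d dvd h * r" "d dvd h * r + 1" using h by (auto intro: dvd_trans)
        then show "is_unit d" by (rule dvd_add_right_iff[THEN iffD1])
      qed
      ultimately have "[v = r] (mod q)" using cong_mult_lcancel_nat by blast
      then show False using that r(3) cong_less_modulus_unique_nat[of v r q] by simp
    qed
    show ?L
    proof (intro allI impI)
      fix u v assume uv: "u < q" "v < q" "u + v < r"
      show "\<exists>s\<in>{0..n}. base_digit p (h * u) s + base_digit p (h * v) s < p - 1"
        using R uv zero[of u] zero[of v] by (cases "u = 0"; cases "v = 0") (auto simp: base_digit_def)
    qed
  qed
  also have "\<dots> \<longleftrightarrow> r \<in> S_set p n"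
    using r unfolding S_set_def q_def[symmetric] h_def by (auto simp: Let_def)
  finally show ?thesis .
qed

section \<open>Valuations and embeddings of fields\<close>

locale field_embedding =
  fixes \<iota> :: "'a::field \<Rightarrow> 'l::field"
  assumes hom: "field_hom \<iota>"
begin

lemma hom_1 [simp]: "\<iota> 1 = 1"
  and hom_add: "\<iota> (x + y) = \<iota> x + \<iota> y"
  and hom_mult: "\<iota> (x * y) = \<iota> x * \<iota> y"
  using hom by (auto simp: field_hom_def)

lemma hom_0 [simp]: "\<iota> 0 = 0"
  using hom_add[of 0 0] by (metis add_cancel_right_right)

lemma hom_minus: "\<iota> (- x) = - \<iota> x"
  using hom_add[of x "- x"] by (simp add: add_eq_0_iff)

lemma hom_diff: "\<iota> (x - y) = \<iota> x - \<iota> y"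
  using hom_add[of x "- y"] by (simp add: hom_minus)

lemma hom_sum: "\<iota> (\<Sum>i\<in>A. f i) = (\<Sum>i\<in>A. \<iota> (f i))"
  by (induction A rule: infinite_finite_induct) (auto simp: hom_add)

lemma hom_prod: "\<iota> (\<Prod>i\<in>A. f i) = (\<Prod>i\<in>A. \<iota> (f i))"
  by (induction A rule: infinite_finite_induct) (auto simp: hom_mult)

lemma hom_power: "\<iota> (x ^ k) = \<iota> x ^ k"
  by (induction k) (auto simp: hom_mult)

lemma hom_of_nat [simp]: "\<iota> (of_nat k) = of_nat k"
  by (induction k) (auto simp: hom_add)

lemma hom_eq_0_iff [simp]: "\<iota> x = 0 \<longleftrightarrow> x = 0"
proof
  assume "\<iota> x = 0"
  then show "x = 0" using hom_mult[of x "inverse x"] by (cases "x = 0") auto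
qed simp

lemma hom_inverse: "\<iota> (inverse x) = inverse (\<iota> x)"
proof (cases "x = 0")
  case False
  then have "\<iota> x * \<iota> (inverse x) = 1" using hom_mult[of x "inverse x"] by simp
  then show ?thesis by (simp add: inverse_unique)
qed simp

lemma hom_divide: "\<iota> (x / y) = \<iota> x / \<iota> y"
  by (simp add: divide_inverse hom_mult hom_inverse)

lemma vector_space: "vector_space (\<lambda>c y. \<iota> c * y)"
  by unfold_locales (auto simp: hom_add hom_mult algebra_simps)

end

text \<open>Subtracting \<tau> z times the relation at y from the relation at z y removes the
  \<tau>-term and multiplies the coefficient of each \<sigma> by \<sigma> z - \<tau> z; for a given
  \<sigma> some z makes this nonzero.\<close>

lemma dedekind_independence:
  assumes "finite F" "\<And>\<sigma>. \<sigma> \<in> F \<Longrightarrow> field_hom \<sigma>" "\<And>y. (\<Sum>\<sigma>\<in>F. l \<sigma> * \<sigma> y) = 0" "\<sigma> \<in> F"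
  shows "l \<sigma> = 0"
  using assms
proof (induction F arbitrary: l \<sigma> rule: finite_induct)
  case (insert \<tau> F)
  have z: "l \<sigma>' = 0" if "\<sigma>' \<in> F" for \<sigma>'
  proof -
    from that insert.hyps have "\<sigma>' \<noteq> \<tau>" by auto
    then obtain z where z: "\<sigma>' z \<noteq> \<tau> z" by auto
    have "(\<Sum>\<sigma>\<in>F. (l \<sigma> * (\<sigma> z - \<tau> z)) * \<sigma> y) = 0" for y
    proof -
      have m: "\<sigma> (z * y) = \<sigma> z * \<sigma> y" if "\<sigma> \<in> insert \<tau> F" for \<sigma>
        using insert.prems(1)[OF that] by (simp add: field_hom_def)
      have "(\<Sum>\<sigma>\<in>insert \<tau> F. l \<sigma> * \<sigma> (z * y)) - \<tau> z * (\<Sum>\<sigma>\<in>insert \<tau> F. l \<sigma> * \<sigma> y) = 0"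
        using insert.prems(2) by simp
      then have "(\<Sum>\<sigma>\<in>insert \<tau> F. l \<sigma> * \<sigma> z * \<sigma> y - \<tau> z * (l \<sigma> * \<sigma> y)) = 0"
        using m by (simp only: sum_subtractf sum_distrib_left mult.assoc cong: sum.cong)
      then show ?thesis using insert.hyps by (simp add: algebra_simps)
    qed
    then have "l \<sigma>' * (\<sigma>' z - \<tau> z) = 0"
      using insert.IH[of "\<lambda>\<sigma>. l \<sigma> * (\<sigma> z - \<tau> z)" \<sigma>'] insert.prems(1) that by auto
    then show ?thesis using z by simp
  qed
  have "(\<Sum>\<sigma>\<in>insert \<tau> F. l \<sigma> * \<sigma> 1) = 0" by (rule insert.prems(2))
  then have "l \<tau> * \<tau> 1 = 0" using insert.hyps z by simp
  moreover have "\<tau> 1 = 1" using insert.prems(1)[of \<tau>] by (simp add: field_hom_def)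
  ultimately show ?case using z insert.prems(3) by auto
qed auto

text \<open>Zero counts as infinitely large, although \<open>fls_subdegree 0 = 0\<close>; this makes
  the bounds stable under sums that happen to vanish.\<close>

definition fge :: "int \<Rightarrow> 'k::field fls \<Rightarrow> bool" where
  "fge m z \<longleftrightarrow> z = 0 \<or> fls_subdegree z \<ge> m"

lemma fge_0 [simp]: "fge m 0"
  by (simp add: fge_def)

lemma fge_add: "fge m x \<Longrightarrow> fge m y \<Longrightarrow> fge m (x + y)"
  unfolding fge_def using fls_plus_subdegree[of x y] by (cases "x + y = 0") auto

lemma fge_sum: "(\<And>i. i \<in> A \<Longrightarrow> fge m (f i)) \<Longrightarrow> fge m (\<Sum>i\<in>A. f i)"
  by (induction A rule: infinite_finite_induct) (auto intro: fge_add)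

lemma fge_mult: "fge k x \<Longrightarrow> fge m y \<Longrightarrow> fge (k + m) (x * y)"
  by (cases "x = 0 \<or> y = 0") (auto simp: fge_def)

lemma fge_mono: "fge m x \<Longrightarrow> k \<le> m \<Longrightarrow> fge k x"
  by (auto simp: fge_def)

section \<open>Valued extensions of K\<close>

locale valued_extension = field_embedding \<iota>
  for \<iota> :: "'k::field fls \<Rightarrow> 'l::field" +
  fixes v :: "'l \<Rightarrow> int"
  assumes nv: "normalized_valuation \<iota> v"
begin

text \<open>The ramification index, read off from the uniformizer \<open>fls_X\<close>.\<close>

definition ram :: int where "ram = v (\<iota> fls_X)"

lemma ram_pos: "ram > 0"
  and v_hom: "z \<noteq> 0 \<Longrightarrow> v (\<iota> z) = ram * fls_subdegree z"
proof -
  obtain e where e: "e > 0" "\<And>z. z \<noteq> 0 \<Longrightarrow> v (\<iota> z) = e * fls_subdegree z"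
    using nv unfolding normalized_valuation_def by blast
  have "ram = e" unfolding ram_def using e(2)[of fls_X] by simp
  then show "ram > 0" "z \<noteq> 0 \<Longrightarrow> v (\<iota> z) = ram * fls_subdegree z" using e by auto
qed

lemma v_mult: "x \<noteq> 0 \<Longrightarrow> y \<noteq> 0 \<Longrightarrow> v (x * y) = v x + v y"
  using nv unfolding normalized_valuation_def by blast

lemma v_add: "x \<noteq> 0 \<Longrightarrow> y \<noteq> 0 \<Longrightarrow> x + y \<noteq> 0 \<Longrightarrow> v (x + y) \<ge> min (v x) (v y)"
  using nv unfolding normalized_valuation_def by blast

lemma v_1 [simp]: "v 1 = 0"
  using v_mult[of 1 1] by simp

lemma v_minus [simp]: "v (- x) = v x"
proof (cases "x = 0")
  case False
  have "v (-1 * -1) = v (-1) + v (-1)" by (rule v_mult) auto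
  then have "v (-1) = 0" by simp
  then show ?thesis using v_mult[of "-1" x] False by simp
qed simp

lemma v_power: "x \<noteq> 0 \<Longrightarrow> v (x ^ k) = int k * v x"
  by (induction k) (auto simp: v_mult algebra_simps)

lemma v_divide: "x \<noteq> 0 \<Longrightarrow> y \<noteq> 0 \<Longrightarrow> v (x / y) = v x - v y"
  using v_mult[of "x / y" y] by simp

lemma v_prod: "(\<And>i. i \<in> A \<Longrightarrow> f i \<noteq> 0) \<Longrightarrow> v (\<Prod>i\<in>A. f i) = (\<Sum>i\<in>A. v (f i))"
  by (induction A rule: infinite_finite_induct) (auto simp: v_mult)

definition vge :: "int \<Rightarrow> 'l \<Rightarrow> bool" where
  "vge m y \<longleftrightarrow> y = 0 \<or> v y \<ge> m"

lemma vge_0 [simp]: "vge m 0"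
  by (simp add: vge_def)

lemma vge_minus [simp]: "vge m (- x) \<longleftrightarrow> vge m x"
  by (auto simp: vge_def)

lemma vge_add: "vge m x \<Longrightarrow> vge m y \<Longrightarrow> vge m (x + y)"
  using v_add[of x y] unfolding vge_def by (cases "x = 0 \<or> y = 0 \<or> x + y = 0") auto

lemma vge_diff: "vge m x \<Longrightarrow> vge m y \<Longrightarrow> vge m (x - y)"
  using vge_add[of m x "- y"] by simp

lemma vge_sum: "(\<And>i. i \<in> A \<Longrightarrow> vge m (f i)) \<Longrightarrow> vge m (\<Sum>i\<in>A. f i)"
  by (induction A rule: infinite_finite_induct) (auto intro: vge_add)

text \<open>If v (x + y) exceeded v x, then x = (x + y) - y would have too large a valuation.
  Writing the strict inequality as \<open>vge (v x + 1) y\<close> covers y = 0.\<close>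

lemma v_add_dominant:
  assumes "x \<noteq> 0" "vge (v x + 1) y"
  shows "x + y \<noteq> 0" "v (x + y) = v x"
proof -
  show nz: "x + y \<noteq> 0"
  proof
    assume "x + y = 0"
    then have "y = - x" by (simp add: add_eq_0_iff)
    then show False using assms by (auto simp: vge_def)
  qed
  show "v (x + y) = v x"
  proof (cases "y = 0")
    case False
    then have y: "v y > v x" using assms by (auto simp: vge_def)
    have "v (x + y) \<ge> v x" using v_add[OF assms(1) False nz] y by simp
    moreover have "v x \<ge> min (v (x + y)) (v (- y))"
      using v_add[OF nz, of "- y"] False assms(1) by simp
    ultimately show ?thesis using y by simp
  qed simp
qed

text \<open>The least valuation among the nonzero terms occurs only once, so it is the valuation of
  the sum.\<close>

lemma vge_terms_of_sum:
  assumes "finite J" "vge m (\<Sum>j\<in>J. t j)" "j \<in> J"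
    and distinct: "\<And>i j. i \<in> J \<Longrightarrow> j \<in> J \<Longrightarrow> t i \<noteq> 0 \<Longrightarrow> t j \<noteq> 0 \<Longrightarrow> v (t i) = v (t j) \<Longrightarrow> i = j"
  shows "vge m (t j)"
proof (cases "t j = 0")
  case False
  define M where "M = {i\<in>J. t i \<noteq> 0}"
  have M: "finite M" "j \<in> M" using assms False by (auto simp: M_def)
  define i where "i = arg_min_on (\<lambda>i. v (t i)) M"
  have i: "i \<in> M" "\<And>k. k \<in> M \<Longrightarrow> v (t i) \<le> v (t k)"
    unfolding i_def using arg_min_if_finite(1)[of M] arg_min_least[of M _ "\<lambda>i. v (t i)"] M by auto
  have "vge (v (t i) + 1) (\<Sum>k\<in>J-{i}. t k)"
  proof (rule vge_sum)
    fix k assume k: "k \<in> J - {i}"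
    show "vge (v (t i) + 1) (t k)"
    proof (cases "t k = 0")
      case False
      then have "v (t i) \<le> v (t k)" using i(2)[of k] k by (auto simp: M_def)
      moreover have "v (t i) \<noteq> v (t k)" using distinct[of i k] i(1) k False by (auto simp: M_def)
      ultimately show ?thesis by (simp add: vge_def)
    qed simp
  qed
  moreover have "t i \<noteq> 0" using i(1) by (simp add: M_def)
  moreover have "(\<Sum>k\<in>J. t k) = t i + (\<Sum>k\<in>J-{i}. t k)"
    using i(1) assms(1) by (intro sum.remove) (auto simp: M_def)
  ultimately have "(\<Sum>k\<in>J. t k) \<noteq> 0" "v (\<Sum>k\<in>J. t k) = v (t i)"
    using v_add_dominant by auto
  then have "m \<le> v (t i)" using assms(2) by (simp add: vge_def)
  also have "\<dots> \<le> v (t j)" using i(2)[OF M(2)] .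
  finally show ?thesis by (simp add: vge_def)
qed simp

lemma sum_eq_0_terms:
  assumes "finite J" "(\<Sum>j\<in>J. t j) = 0" "j \<in> J"
    and distinct: "\<And>i j. i \<in> J \<Longrightarrow> j \<in> J \<Longrightarrow> t i \<noteq> 0 \<Longrightarrow> t j \<noteq> 0 \<Longrightarrow> v (t i) = v (t j) \<Longrightarrow> i = j"
  shows "t j = 0"
  \<comment> \<open>Zero satisfies every bound, including the one just above the valuation of
    \<open>t j\<close>.\<close>
  using vge_terms_of_sum[OF assms(1) _ assms(3), of "v (t j) + 1" t] assms(2) distinct
  by (auto simp: vge_def)

end

section \<open>Freeness over the associated order\<close>

locale valued_basis = valued_extension \<iota> v
  for \<iota> :: "'k::field fls \<Rightarrow> 'l::field" and v +
  fixes q :: nat and e :: "nat \<Rightarrow> 'l" and w :: "nat \<Rightarrow> int"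
  assumes q: "q > 0"
    and ram: "ram = int q"
    and e_nz: "j < q \<Longrightarrow> e j \<noteq> 0"
    and v_e: "j < q \<Longrightarrow> v (e j) = - w j"
    and w_inj: "i < q \<Longrightarrow> j < q \<Longrightarrow> w i mod int q = w j mod int q \<Longrightarrow> i = j"
    and spanning: "\<exists>c. y = (\<Sum>j<q. \<iota> (c j) * e j)"
begin

definition comb :: "(nat \<Rightarrow> 'k fls) \<Rightarrow> 'l" where
  "comb c = (\<Sum>j<q. \<iota> (c j) * e j)"

text \<open>The ceiling of w_j / q, that is, the least m for which t^m e_j is integral, t being the
  uniformizer of K.\<close>

definition d :: "nat \<Rightarrow> int" where
  "d j = - ((- w j) div int q)"

lemma comb_ex: "\<exists>c. y = comb c"
  using spanning unfolding comb_def .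

lemma comb_diff: "comb (\<lambda>j. c j - c' j) = comb c - comb c'"
  by (simp add: comb_def hom_diff left_diff_distrib sum_subtractf)

lemma comb_scale: "\<iota> z * comb c = comb (\<lambda>j. z * c j)"
  by (simp add: comb_def hom_mult sum_distrib_left mult.assoc)

lemma comb_sum: "(\<Sum>i\<in>A. comb (c i)) = comb (\<lambda>j. \<Sum>i\<in>A. c i j)"
  unfolding comb_def hom_sum sum_distrib_right by (rule sum.swap)

lemma term_distinct:
  assumes "i < q" "j < q" "\<iota> (c i) * e i \<noteq> 0" "\<iota> (c j) * e j \<noteq> 0"
    "v (\<iota> (c i) * e i) = v (\<iota> (c j) * e j)"
  shows "i = j"
proof (rule w_inj)
  have "int q * fls_subdegree (c i) - w i = int q * fls_subdegree (c j) - w j"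
    using assms by (simp add: v_mult v_hom v_e ram)
  then have "w i = w j + int q * (fls_subdegree (c i) - fls_subdegree (c j))"
    by (simp add: right_diff_distrib)
  then show "w i mod int q = w j mod int q" by simp
qed (use assms in auto)

lemma comb_eq_0: "comb c = 0 \<Longrightarrow> j < q \<Longrightarrow> c j = 0"
  using sum_eq_0_terms[of "{..<q}" "\<lambda>j. \<iota> (c j) * e j" j] term_distinct e_nz
  by (auto simp: comb_def)

lemma comb_inj: "comb c = comb c' \<Longrightarrow> j < q \<Longrightarrow> c j = c' j"
  using comb_eq_0[of "\<lambda>j. c j - c' j" j] by (simp add: comb_diff)

lemma le_ceiling_iff: "d j \<le> m \<longleftrightarrow> int q * m - w j \<ge> 0"
proof -
  have "d j \<le> m \<longleftrightarrow> - m \<le> (- w j) div int q" by (auto simp: d_def)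
  also have "\<dots> \<longleftrightarrow> (- m) * int q \<le> - w j"
  proof
    assume "- m \<le> (- w j) div int q"
    then have "(- m) * int q \<le> (- w j) div int q * int q" by (intro mult_right_mono) auto
    also have "\<dots> \<le> - w j" using q div_mult_mod_eq[of "- w j" "int q"] pos_mod_sign[of "int q" "- w j"]
      by linarith
    finally show "(- m) * int q \<le> - w j" .
  next
    assume "(- m) * int q \<le> - w j"
    then have "((- m) * int q) div int q \<le> (- w j) div int q" using q by (intro zdiv_mono1) auto
    moreover have "((- m) * int q) div int q = - m" using q by (intro nonzero_mult_div_cancel_right) simp
    ultimately show "- m \<le> (- w j) div int q" by simp
  qed
  finally show ?thesis by (auto simp: mult.commute)
qed

text \<open>The nonzero terms have valuations distinct modulo q, so integrality is decided term by
  term. Hence the t^(d j) e_j form an O_K-basis of O_L.\<close>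

lemma comb_in_valuation_ring: "comb c \<in> valuation_ring v \<longleftrightarrow> (\<forall>j<q. fge (d j) (c j))"
proof -
  have t: "vge 0 (\<iota> (c j) * e j) \<longleftrightarrow> fge (d j) (c j)" if "j < q" for j
    using that e_nz[OF that]
    by (cases "c j = 0") (auto simp: vge_def fge_def v_mult v_hom ram v_e le_ceiling_iff)
  have "comb c \<in> valuation_ring v \<longleftrightarrow> vge 0 (comb c)"
    by (auto simp: vge_def valuation_ring_def)
  also have "\<dots> \<longleftrightarrow> (\<forall>j<q. vge 0 (\<iota> (c j) * e j))"
    unfolding comb_def using vge_terms_of_sum[of "{..<q}" 0 "\<lambda>j. \<iota> (c j) * e j"] term_distinct
    by (auto intro: vge_sum)
  finally show ?thesis using t by blast
qed

end

section \<open>The group algebra acting by shifts\<close>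

locale shift_basis = valued_basis \<iota> v q e w
  for \<iota> :: "'k::field fls \<Rightarrow> 'l::field" and v q e w +
  fixes N :: "nat \<Rightarrow> nat \<Rightarrow> bool"
  assumes N_less: "N a i \<Longrightarrow> a + i < q"
    and N_complement: "i < q \<Longrightarrow> N (q - 1 - i) i"
    and N_0: "i < q \<Longrightarrow> N 0 i"
    and galois_finite: "finite (galois_group \<iota>)"
    and galois_card: "card (galois_group \<iota>) \<ge> q"
    and galois_shift: "\<sigma> \<in> galois_group \<iota> \<Longrightarrow>
      \<exists>c. \<forall>j<q. \<sigma> (e j) = (\<Sum>a | a \<le> j \<and> N a (j - a). \<iota> (c a) * e (j - a))"
begin

abbreviation act where "act \<equiv> group_algebra_act \<iota>"
abbreviation O_L where "O_L \<equiv> valuation_ring v"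
abbreviation A_L where "A_L \<equiv> associated_order \<iota> v"
abbreviation t where "t m \<equiv> (fls_X_intpow m :: 'k fls)"

text \<open>The operator sends e_j to the sum of the c_a e_(j-a), so coordinate i of the image
  collects contributions from e_(a+i). \<open>N\<close> stands for absence of carries.\<close>

definition shift :: "(nat \<Rightarrow> 'k fls) \<Rightarrow> (nat \<Rightarrow> 'k fls) \<Rightarrow> nat \<Rightarrow> 'k fls" where
  "shift c u i = (\<Sum>a | N a i. c a * u (a + i))"

definition represents :: "(('l \<Rightarrow> 'l) \<Rightarrow> 'k fls) \<Rightarrow> (nat \<Rightarrow> 'k fls) \<Rightarrow> bool" where
  "represents \<alpha> c \<longleftrightarrow> (\<forall>u. act \<alpha> (comb u) = comb (shift c u))"

lemma finite_N: "finite {a. N a i}"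
  by (rule finite_subset[of _ "{..<q}"]) (use N_less in force)+

lemma galois_hom: "\<sigma> \<in> galois_group \<iota> \<Longrightarrow> field_embedding \<sigma>"
  by (simp add: galois_group_def field_embedding_def)

lemma galois_fixes: "\<sigma> \<in> galois_group \<iota> \<Longrightarrow> \<sigma> (\<iota> c) = \<iota> c"
  by (simp add: galois_group_def)

lemma galois_comb:
  assumes "\<sigma> \<in> galois_group \<iota>"
  shows "\<exists>c. \<forall>u. \<sigma> (comb u) = comb (shift c u)"
proof -
  interpret \<sigma>: field_embedding \<sigma> using galois_hom[OF assms] .
  obtain c where c: "\<And>j. j < q \<Longrightarrow> \<sigma> (e j) = (\<Sum>a | a \<le> j \<and> N a (j - a). \<iota> (c a) * e (j - a))"
    using galois_shift[OF assms] by blast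
  have fin: "finite {a. a \<le> j \<and> N a (j - a)}" for j
    by (rule finite_subset[of _ "{..j}"]) auto
  have "\<sigma> (comb u) = comb (shift c u)" for u
  proof -
    have "\<sigma> (comb u) = (\<Sum>j<q. \<iota> (u j) * \<sigma> (e j))"
      unfolding comb_def by (simp add: \<sigma>.hom_sum \<sigma>.hom_mult galois_fixes[OF assms])
    also have "\<dots> = (\<Sum>j<q. \<Sum>a | a \<le> j \<and> N a (j - a). \<iota> (c a * u j) * e (j - a))"
      by (intro sum.cong refl) (simp add: c sum_distrib_left hom_mult ac_simps)
    also have "\<dots> = (\<Sum>(j, a)\<in>(SIGMA j:{..<q}. {a. a \<le> j \<and> N a (j - a)}). \<iota> (c a * u j) * e (j - a))"
      using fin by (intro sum.Sigma) auto
    \<comment> \<open>The sum is reorganized by the target index i = j - a.\<close>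
    also have "\<dots> = (\<Sum>(i, a)\<in>(SIGMA i:{..<q}. {a. N a i}). \<iota> (c a * u (a + i)) * e i)"
      by (rule sum.reindex_bij_witness[of _ "\<lambda>(i, a). (a + i, a)" "\<lambda>(j, a). (j - a, a)"])
        (auto dest: N_less)
    also have "\<dots> = (\<Sum>i<q. \<Sum>a | N a i. \<iota> (c a * u (a + i)) * e i)"
      using finite_N by (intro sum.Sigma[symmetric]) auto
    also have "\<dots> = comb (shift c u)"
      unfolding comb_def shift_def by (simp add: hom_sum sum_distrib_right)
    finally show ?thesis .
  qed
  then show ?thesis by blast
qed

lemma represents_ex: "\<exists>c. represents \<alpha> c"
proof -
  obtain c where c: "\<And>\<sigma> u. \<sigma> \<in> galois_group \<iota> \<Longrightarrow> \<sigma> (comb u) = comb (shift (c \<sigma>) u)"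
    using galois_comb by metis
  have "represents \<alpha> (\<lambda>a. \<Sum>\<sigma>\<in>galois_group \<iota>. \<alpha> \<sigma> * c \<sigma> a)"
    unfolding represents_def
  proof
    fix u
    have "act \<alpha> (comb u) = (\<Sum>\<sigma>\<in>galois_group \<iota>. comb (\<lambda>i. \<alpha> \<sigma> * shift (c \<sigma>) u i))"
      unfolding group_algebra_act_def by (simp add: c comb_scale)
    also have "\<dots> = comb (\<lambda>i. \<Sum>\<sigma>\<in>galois_group \<iota>. \<alpha> \<sigma> * shift (c \<sigma>) u i)"
      by (rule comb_sum)
    also have "(\<lambda>i. \<Sum>\<sigma>\<in>galois_group \<iota>. \<alpha> \<sigma> * shift (c \<sigma>) u i)
        = shift (\<lambda>a. \<Sum>\<sigma>\<in>galois_group \<iota>. \<alpha> \<sigma> * c \<sigma> a) u"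
      unfolding shift_def sum_distrib_left sum_distrib_right
      by (subst sum.swap) (simp add: mult.assoc)
    finally show "act \<alpha> (comb u) = comb (shift (\<lambda>a. \<Sum>\<sigma>\<in>galois_group \<iota>. \<alpha> \<sigma> * c \<sigma> a) u)" .
  qed
  then show ?thesis by blast
qed

text \<open>Coordinate q - 1 - m is reached only by shifts with a \<le> m, because a + (q - 1 - m) <
  q. This is the triangularity used below: reading coordinates downwards from q - 1 determines c 0,
  c 1, and so on.\<close>

lemma shift_at:
  assumes "m < q" "\<And>a. a < m \<Longrightarrow> c a = 0"
  shows "shift c u (q - 1 - m) = c m * u (q - 1)"
proof -
  have "shift c u (q - 1 - m) = (\<Sum>a\<in>{m}. c a * u (a + (q - 1 - m)))"
    unfolding shift_def
  proof (rule sum.mono_neutral_right)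
    show "{m} \<subseteq> {a. N a (q - 1 - m)}"
      using N_complement[of "q - 1 - m"] assms(1) by (simp add: Suc_leI)
    show "\<forall>i\<in>{a. N a (q - 1 - m)} - {m}. c i * u (i + (q - 1 - m)) = 0"
    proof safe
      fix a assume "N a (q - 1 - m)" "a \<notin> {}" "c a * u (a + (q - 1 - m)) \<noteq> 0"
      then show "a = m" using N_less[of a "q - 1 - m"] assms(2)[of a] assms(1) by force
    qed
  qed (rule finite_N)
  then show ?thesis using assms(1) by simp
qed

lemma shift_eq_0:
  assumes "comb (shift c u) = 0" "u (q - 1) \<noteq> 0" "m < q"
  shows "c m = 0"
  using assms(3)
proof (induction m rule: less_induct)
  case (less m)
  have "shift c u (q - 1 - m) = 0" using comb_eq_0[OF assms(1)] less.prems by simp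
  moreover have "shift c u (q - 1 - m) = c m * u (q - 1)" using less by (intro shift_at) auto
  ultimately show ?case using assms(2) by simp
qed

lemma act_diff: "act (\<lambda>\<sigma>. \<alpha> \<sigma> - \<alpha>' \<sigma>) y = act \<alpha> y - act \<alpha>' y"
  by (simp add: group_algebra_act_def hom_diff left_diff_distrib sum_subtractf)

lemma act_scale: "act (\<lambda>\<sigma>. z * \<alpha> \<sigma>) y = \<iota> z * act \<alpha> y"
  by (simp add: group_algebra_act_def hom_mult sum_distrib_left mult.assoc)

lemma act_0 [simp]: "act (\<lambda>_. 0) y = 0"
  by (simp add: group_algebra_act_def)

text \<open>By \<open>shift_eq_0\<close> all shift coefficients vanish, so the operator is zero on
  all of L, and independence of automorphisms applies.\<close>

lemma act_eq_0:
  assumes "act \<alpha> (comb u) = 0" "u (q - 1) \<noteq> 0" "\<sigma> \<in> galois_group \<iota>"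
  shows "\<alpha> \<sigma> = 0"
proof -
  obtain c where c: "represents \<alpha> c" using represents_ex by blast
  then have "comb (shift c u) = 0" using assms(1) by (simp add: represents_def)
  then have c0: "c m = 0" if "m < q" for m using shift_eq_0 assms(2) that by blast
  have "shift c u' i = 0" for u' i
    unfolding shift_def using c0 N_less by (intro sum.neutral) force
  then have "act \<alpha> (comb u') = 0" for u'
    using c by (simp add: represents_def comb_def)
  then have "act \<alpha> y = 0" for y using comb_ex by metis
  then have "\<iota> (\<alpha> \<sigma>) = 0"
    using dedekind_independence[OF galois_finite, of "\<lambda>\<sigma>. \<iota> (\<alpha> \<sigma>)" \<sigma>] assms(3)
    by (auto simp: group_algebra_act_def galois_group_def)
  then show ?thesis by simp
qed

lemma act_inj:
  assumes "act \<alpha> (comb u) = act \<alpha>' (comb u)" "u (q - 1) \<noteq> 0"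
    "\<alpha> \<in> group_algebra \<iota>" "\<alpha>' \<in> group_algebra \<iota>"
  shows "\<alpha> = \<alpha>'"
proof
  fix \<sigma>
  show "\<alpha> \<sigma> = \<alpha>' \<sigma>"
    using act_eq_0[of "\<lambda>\<sigma>. \<alpha> \<sigma> - \<alpha>' \<sigma>" u \<sigma>] assms
    by (cases "\<sigma> \<in> galois_group \<iota>") (auto simp: act_diff group_algebra_def)
qed

text \<open>By \<open>act_eq_0\<close> the conjugates of \<open>comb u\<close> are distinct and
  independent over K. There are at least q of them in a space spanned by q elements, so they form a
  normal basis.\<close>

lemma act_surj:
  assumes u: "u (q - 1) \<noteq> 0"
  shows "\<exists>\<alpha>\<in>group_algebra \<iota>. act \<alpha> (comb u) = y"
proof -
  interpret V: vector_space "\<lambda>c y. \<iota> c * y" by (rule vector_space)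
  define ev where "ev = (\<lambda>\<sigma>::'l \<Rightarrow> 'l. \<sigma> (comb u))"
  have inj: "inj_on ev (galois_group \<iota>)"
  proof
    fix \<sigma> \<tau> assume *: "\<sigma> \<in> galois_group \<iota>" "\<tau> \<in> galois_group \<iota>" "ev \<sigma> = ev \<tau>"
    show "\<sigma> = \<tau>"
    proof (rule ccontr)
      assume ne: "\<sigma> \<noteq> \<tau>"
      \<comment> \<open>The element \<sigma> - \<tau> of K[G], which kills
        \<open>comb u\<close>.\<close>
      define \<alpha> where "\<alpha> = (\<lambda>\<rho>. (if \<rho> = \<sigma> then 1 else 0) - (if \<rho> = \<tau> then 1 else 0) :: 'k fls)"
      have "act \<alpha> (comb u) = (\<Sum>\<rho>\<in>galois_group \<iota>. (if \<rho> = \<sigma> then \<rho> (comb u) else 0)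
          - (if \<rho> = \<tau> then \<rho> (comb u) else 0))"
        unfolding group_algebra_act_def \<alpha>_def by (intro sum.cong) (auto simp: hom_diff hom_minus)
      also have "\<dots> = 0"
        using * galois_finite by (simp add: sum_subtractf ev_def)
      finally have "\<alpha> \<sigma> = 0" using act_eq_0 u *(1) by blast
      then show False using ne by (simp add: \<alpha>_def)
    qed
  qed
  define S where "S = ev ` galois_group \<iota>"
  have finS: "finite S" unfolding S_def using galois_finite by simp
  have act_S: "(\<Sum>s\<in>S. \<iota> (g s) * s) = act (\<lambda>\<sigma>. if \<sigma> \<in> galois_group \<iota> then g (ev \<sigma>) else 0) (comb u)" for g
    unfolding S_def sum.reindex[OF inj] group_algebra_act_def by (auto simp: ev_def cong: sum.cong)
  have indep: "V.independent S"
  proof (rule V.independent_if_scalars_zero[OF finS])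
    fix g s assume *: "(\<Sum>s\<in>S. \<iota> (g s) * s) = 0" "s \<in> S"
    then obtain \<sigma> where \<sigma>: "\<sigma> \<in> galois_group \<iota>" "s = ev \<sigma>" by (auto simp: S_def)
    show "g s = 0"
      using act_eq_0[of "\<lambda>\<sigma>. if \<sigma> \<in> galois_group \<iota> then g (ev \<sigma>) else 0" u \<sigma>] u * act_S \<sigma> by simp
  qed
  have span_e: "x \<in> V.span (e ` {..<q})" for x
  proof -
    obtain c where "x = comb c" using comb_ex by blast
    then show ?thesis
      unfolding comb_def by (simp only:) (intro V.span_sum V.span_scale V.span_base, auto)
  qed
  have "y \<in> V.span S"
  proof (rule ccontr)
    assume y: "y \<notin> V.span S"
    then have "V.independent (insert y S)" using indep by (rule V.independent_insertI)
    then have "card (insert y S) \<le> card (e ` {..<q})"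
      using V.independent_span_bound[of "e ` {..<q}" "insert y S"] span_e by auto
    also have "\<dots> \<le> q" using card_image_le[of "{..<q}" e] by simp
    also have "q \<le> card S" unfolding S_def using galois_card card_image[OF inj] by simp
    also have "card S < card (insert y S)"
      using y finS V.span_base by (subst card_insert_disjoint) auto
    finally show False by simp
  qed
  then obtain g where "y = (\<Sum>s\<in>S. \<iota> (g s) * s)"
    unfolding V.span_finite[OF finS] by auto
  then show ?thesis unfolding act_S
    by (intro bexI[of _ "\<lambda>\<sigma>. if \<sigma> \<in> galois_group \<iota> then g (ev \<sigma>) else 0"]) (auto simp: group_algebra_def)
qed

text \<open>For necessity the operator is tested on the integral element t^(d (a + i)) e_(a+i),
  whose image has coordinate c_a t^(d (a + i)) at i. For sufficiency each summand of
  \<open>shift\<close> is bounded separately.\<close>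

lemma associated_order_iff:
  assumes "\<alpha> \<in> group_algebra \<iota>" "represents \<alpha> c"
  shows "\<alpha> \<in> A_L \<longleftrightarrow> (\<forall>a i. N a i \<longrightarrow> fge (d i - d (a + i)) (c a))"
proof
  assume \<alpha>: "\<alpha> \<in> A_L"
  show "\<forall>a i. N a i \<longrightarrow> fge (d i - d (a + i)) (c a)"
  proof (intro allI impI)
    fix a i assume N: "N a i"
    then have l: "a + i < q" by (rule N_less)
    define u where "u = (\<lambda>j. if j = a + i then t (d (a + i)) else 0)"
    have "comb u \<in> O_L" unfolding comb_in_valuation_ring by (simp add: u_def fge_def)
    then have "act \<alpha> (comb u) \<in> O_L" using \<alpha> by (auto simp: associated_order_def)
    then have "fge (d i) (shift c u i)"
      using assms(2) l by (simp add: represents_def comb_in_valuation_ring)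
    also have "shift c u i = (\<Sum>b\<in>{a}. c b * u (b + i))"
      unfolding shift_def using finite_N N by (intro sum.mono_neutral_right) (auto simp: u_def)
    finally show "fge (d i - d (a + i)) (c a)"
      by (cases "c a = 0") (auto simp: u_def fge_def fls_subdegree_mult_fls_X_intpow)
  qed
next
  assume c: "\<forall>a i. N a i \<longrightarrow> fge (d i - d (a + i)) (c a)"
  have "act \<alpha> y \<in> O_L" if "y \<in> O_L" for y
  proof -
    obtain u where y: "y = comb u" using comb_ex by blast
    have "fge (d i) (shift c u i)" if "i < q" for i
      unfolding shift_def
    proof (rule fge_sum)
      fix a assume a: "a \<in> {a. N a i}"
      then have "fge (d i - d (a + i) + d (a + i)) (c a * u (a + i))"
        using c \<open>y \<in> O_L\<close> N_less by (intro fge_mult) (auto simp: y comb_in_valuation_ring)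
      then show "fge (d i) (c a * u (a + i))" by simp
    qed
    then show ?thesis using assms(2) by (simp add: y represents_def comb_in_valuation_ring)
  qed
  then show "\<alpha> \<in> A_L" using assms(1) by (auto simp: associated_order_def)
qed

text \<open>One exponent m clears all denominators of \<alpha>; being nonnegative, it also keeps t^m
  times the identity in the order. In \<open>ceiling_condition_if_free\<close> this yields two
  expressions of one element, which excludes a second basis vector.\<close>

lemma associated_order_scale:
  assumes "\<alpha> \<in> group_algebra \<iota>"
  shows "\<exists>m\<ge>0. (\<lambda>\<sigma>. t m * \<alpha> \<sigma>) \<in> A_L \<and> (\<lambda>\<sigma>. if \<sigma> = id then t m else 0) \<in> A_L"
proof -
  obtain c where c: "represents \<alpha> c" using represents_ex by blast
  define F where "F = (\<lambda>(a, i). d i - d (a + i) - fls_subdegree (c a)) ` ({..<q} \<times> {..<q})"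
  define m where "m = Max (insert 0 F)"
  have fin: "finite (insert 0 F)" by (simp add: F_def)
  have m0: "m \<ge> 0" unfolding m_def using fin by (intro Max_ge) auto
  have mF: "d i - d (a + i) - fls_subdegree (c a) \<le> m" if "a < q" "i < q" for a i
    unfolding m_def using fin that by (intro Max_ge) (auto simp: F_def)
  have rep: "represents (\<lambda>\<sigma>. t m * \<alpha> \<sigma>) (\<lambda>a. t m * c a)"
    unfolding represents_def
  proof
    fix u
    have "shift (\<lambda>a. t m * c a) u = (\<lambda>i. t m * shift c u i)"
      unfolding shift_def by (simp only: sum_distrib_left mult.assoc)
    then show "act (\<lambda>\<sigma>. t m * \<alpha> \<sigma>) (comb u) = comb (shift (\<lambda>a. t m * c a) u)"
      using c by (simp only: represents_def act_scale comb_scale)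
  qed
  have GA: "(\<lambda>\<sigma>. t m * \<alpha> \<sigma>) \<in> group_algebra \<iota>" using assms by (simp add: group_algebra_def)
  have "(\<lambda>\<sigma>. t m * \<alpha> \<sigma>) \<in> A_L"
    unfolding associated_order_iff[OF GA rep]
  proof (intro allI impI)
    fix a i assume "N a i"
    then have "d i - d (a + i) - fls_subdegree (c a) \<le> m" by (intro mF) (auto dest: N_less)
    then show "fge (d i - d (a + i)) (t m * c a)"
      by (cases "c a = 0") (simp_all add: fge_def fls_subdegree_mult_fls_X_intpow del: fls_subdegree_mult)
  qed
  moreover have "(\<lambda>\<sigma>. if \<sigma> = id then t m else 0) \<in> A_L"
  proof -
    have id: "id \<in> galois_group \<iota>" by (simp add: galois_group_def field_hom_def)
    have "act (\<lambda>\<sigma>. if \<sigma> = id then t m else 0) y = (\<Sum>\<sigma>\<in>galois_group \<iota>. if \<sigma> = id then \<iota> (t m) * y else 0)" for y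
      unfolding group_algebra_act_def by (intro sum.cong) auto
    then have "act (\<lambda>\<sigma>. if \<sigma> = id then t m else 0) y = \<iota> (t m) * y" for y
      using id galois_finite by simp
    moreover have "\<iota> (t m) * y \<in> O_L" if "y \<in> O_L" for y
      using that m0 ram_pos by (cases "y = 0") (auto simp: valuation_ring_def v_mult v_hom)
    ultimately show ?thesis using id by (auto simp: associated_order_def group_algebra_def)
  qed
  ultimately show ?thesis using m0 by blast
qed

text \<open>Over \<open>K[G]\<close>, which acts through the shift operators, \<open>L\<close> is free on \<open>e\<^sub>q\<^sub>-\<^sub>1\<close>; this makes the
  comparison of \<open>O\<^sub>L\<close> with \<open>A\<^sub>L\<close> a triangular one.\<close>

theorem free_if_ceiling_condition:
  assumes cond: "\<And>a i. N a i \<Longrightarrow> d (q - 1) - d (q - 1 - a) \<le> d (a + i) - d i"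
  shows "free_over_associated_order \<iota> v"
proof -
  \<comment> \<open>The candidate generator is e_(q-1) times the least power of t that makes it
    integral.\<close>
  define u where "u = (\<lambda>j. if j = q - 1 then t (d (q - 1)) else 0)"
  define \<rho> where "\<rho> = comb u"
  have u1: "u (q - 1) \<noteq> 0" by (simp add: u_def)
  have \<rho>: "\<rho> \<in> O_L" unfolding \<rho>_def comb_in_valuation_ring by (simp add: u_def fge_def)
  have ex1: "\<exists>!\<alpha>. \<alpha> \<in> A_L \<and> y = act \<alpha> \<rho>" if y: "y \<in> O_L" for y
  proof -
    obtain r where r: "y = comb r" using comb_ex by blast
    obtain \<alpha> where \<alpha>: "\<alpha> \<in> group_algebra \<iota>" "act \<alpha> \<rho> = y" using act_surj[of u y] u1 \<rho>_def by blast
    obtain c where c: "represents \<alpha> c" using represents_ex by blast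
    \<comment> \<open>Coordinate q - 1 - a of the equation \<alpha> \<rho> = y reads c_a t^(d (q -
      1)) = r_(q-1-a), and integrality of y bounds the right side.\<close>
    have ca: "fge (d (q - 1 - a) - d (q - 1)) (c a)" if "a < q" for a
    proof -
      have "comb (shift c u) = comb r" using c \<alpha>(2) r by (simp add: represents_def \<rho>_def)
      then have "r (q - 1 - a) = shift c u (q - 1 - a)"
        using comb_inj[of "shift c u" r "q - 1 - a"] q by simp
      also have "\<dots> = (\<Sum>b\<in>{a}. c b * u (b + (q - 1 - a)))"
        unfolding shift_def using finite_N N_complement[of "q - 1 - a"] that
        by (intro sum.mono_neutral_right) (auto simp: u_def)
      finally have "r (q - 1 - a) = c a * t (d (q - 1))" using that by (simp add: u_def)
      moreover have "fge (d (q - 1 - a)) (r (q - 1 - a))"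
        using y q by (simp add: r comb_in_valuation_ring)
      ultimately show ?thesis
        by (cases "c a = 0") (auto simp: fge_def fls_subdegree_mult_fls_X_intpow)
    qed
    have "\<alpha> \<in> A_L"
      unfolding associated_order_iff[OF \<alpha>(1) c]
    proof (intro allI impI)
      fix a i assume N: "N a i"
      have "fge (d (q - 1 - a) - d (q - 1)) (c a)" using ca N_less[OF N] by simp
      \<comment> \<open>The assumed inequality makes the bound from integrality of y at least as
        strong as the one required here.\<close>
      then show "fge (d i - d (a + i)) (c a)" by (rule fge_mono) (use cond[OF N] in simp)
    qed
    then show ?thesis using \<alpha> act_inj[of _ u] u1
      by (intro ex1I[of _ \<alpha>]) (auto simp: \<rho>_def associated_order_def)
  qed
  \<comment> \<open>If \<open>c \<rho>\<close> is zero the support is empty; the equation survives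
    because zero acts as zero.\<close>
  have single: "(\<Sum>x | c x \<noteq> (\<lambda>_. 0). act (c x) x) = act (c \<rho>) \<rho>"
    if "\<And>x. x \<notin> {\<rho>} \<Longrightarrow> c x = (\<lambda>_. 0)" for c
  proof -
    have "(\<Sum>x | c x \<noteq> (\<lambda>_. 0). act (c x) x) = (\<Sum>x\<in>{\<rho>}. act (c x) x)"
      using that by (intro sum.mono_neutral_left) auto
    then show ?thesis by simp
  qed
  show ?thesis
    unfolding free_over_associated_order_def is_free_module_def
  proof (intro exI[of _ "{\<rho>}"] conjI ballI)
    fix y assume "y \<in> O_L"
    then obtain \<alpha> where \<alpha>: "\<alpha> \<in> A_L" "y = act \<alpha> \<rho>" "\<And>\<alpha>'. \<alpha>' \<in> A_L \<Longrightarrow> y = act \<alpha>' \<rho> \<Longrightarrow> \<alpha>' = \<alpha>"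
      using ex1 by blast
    show "\<exists>!c. (\<forall>w\<in>{\<rho>}. c w \<in> A_L) \<and> (\<forall>w. w \<notin> {\<rho>} \<longrightarrow> c w = (\<lambda>_. 0)) \<and>
      finite {w. c w \<noteq> (\<lambda>_. 0)} \<and> y = (\<Sum>w | c w \<noteq> (\<lambda>_. 0). act (c w) w)"
    proof (rule ex1I[of _ "\<lambda>x. if x = \<rho> then \<alpha> else (\<lambda>_. 0)"])
      show "(\<forall>w\<in>{\<rho>}. (if w = \<rho> then \<alpha> else (\<lambda>_. 0)) \<in> A_L) \<and>
        (\<forall>w. w \<notin> {\<rho>} \<longrightarrow> (if w = \<rho> then \<alpha> else (\<lambda>_. 0)) = (\<lambda>_. 0)) \<and>
        finite {w. (if w = \<rho> then \<alpha> else (\<lambda>_. 0)) \<noteq> (\<lambda>_. 0)} \<and>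
        y = (\<Sum>w | (if w = \<rho> then \<alpha> else (\<lambda>_. 0)) \<noteq> (\<lambda>_. 0). act (if w = \<rho> then \<alpha> else (\<lambda>_. 0)) w)"
        using \<alpha> by (subst single) (auto intro: finite_subset[of _ "{\<rho>}"])
    next
      fix c assume c: "(\<forall>w\<in>{\<rho>}. c w \<in> A_L) \<and> (\<forall>w. w \<notin> {\<rho>} \<longrightarrow> c w = (\<lambda>_. 0)) \<and>
        finite {w. c w \<noteq> (\<lambda>_. 0)} \<and> y = (\<Sum>w | c w \<noteq> (\<lambda>_. 0). act (c w) w)"
      then have "y = act (c \<rho>) \<rho>" using single[of c] by simp
      then have "c \<rho> = \<alpha>" using \<alpha>(3)[of "c \<rho>"] c by simp
      then show "c = (\<lambda>x. if x = \<rho> then \<alpha> else (\<lambda>_. 0))" using c by auto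
    qed
  qed (use \<rho> in auto)
qed

text \<open>The associated order multiplies the top coordinate by integral scalars, so some basis
  vector \<rho> has a top coordinate of least possible valuation. Any other basis vector would be a
  K[G]-multiple of \<rho>, against uniqueness of coefficients. Expressing t^(d (q - 1 - a))
  e_(q-1-a) through \<rho> gives an operator whose coefficient at a has valuation d (q - 1 - a) - d
  (q - 1); membership in the order bounds it from below.\<close>

theorem ceiling_condition_if_free:
  assumes free: "free_over_associated_order \<iota> v" and N: "N a i"
  shows "d (q - 1) - d (q - 1 - a) \<le> d (a + i) - d i"
proof -
  define Z where "Z = (\<lambda>_ :: 'l \<Rightarrow> 'l. 0 :: 'k fls)"
  define R where "R = (\<lambda>B y c. (\<forall>w\<in>B. c w \<in> A_L) \<and> (\<forall>w. w \<notin> B \<longrightarrow> c w = Z) \<and>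
      finite {w. c w \<noteq> Z} \<and> y = (\<Sum>w | c w \<noteq> Z. act (c w) w))"
  have "\<exists>B\<subseteq>O_L. \<forall>y\<in>O_L. \<exists>c. R B y c \<and> (\<forall>c'. R B y c' \<longrightarrow> c' = c)"
    using free unfolding free_over_associated_order_def is_free_module_def Z_def R_def Ex1_def .
  then obtain B where B: "B \<subseteq> O_L" and R: "\<forall>y\<in>O_L. \<exists>c. R B y c \<and> (\<forall>c'. R B y c' \<longrightarrow> c' = c)"
    by (elim exE conjE) (rule that)
  have rep: "\<exists>c. R B y c" if "y \<in> O_L" for y
    using R that by blast
  have uniq: "c = c'" if "y \<in> O_L" "R B y c" "R B y c'" for y c c'
    using R that by metis
  have q1: "q - 1 < q" using q by simp
  have top: "shift c u (q - 1) = c 0 * u (q - 1)" for c u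
    using shift_at[of 0 c u] q by simp
  have "\<exists>\<rho>\<in>B. \<exists>u. \<rho> = comb u \<and> u (q - 1) \<noteq> 0 \<and> fls_subdegree (u (q - 1)) = d (q - 1)"
  proof (rule ccontr)
    assume neg: "\<not> ?thesis"
    define y where "y = comb (\<lambda>j. if j = q - 1 then t (d (q - 1)) else 0)"
    have "y \<in> O_L" unfolding y_def comb_in_valuation_ring by (simp add: fge_def)
    then obtain c where "R B y c" using rep by blast
    then have c: "\<And>w. w \<in> B \<Longrightarrow> c w \<in> A_L" "\<And>w. w \<notin> B \<Longrightarrow> c w = Z"
      "y = (\<Sum>w | c w \<noteq> Z. act (c w) w)" by (simp_all add: R_def)
    have "\<exists>r. act (c w) w = comb r \<and> fge (d (q - 1) + 1) (r (q - 1))" if "c w \<noteq> Z" for w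
    proof -
      have w: "w \<in> B" using c(2) that by blast
      obtain u where u: "w = comb u" using comb_ex by blast
      obtain g where g: "represents (c w) g" using represents_ex by blast
      have "fge (d (q - 1)) (u (q - 1))" using w B u q1 comb_in_valuation_ring by blast
      then have u1: "fge (d (q - 1) + 1) (u (q - 1))" using neg w u by (force simp: fge_def)
      have "c w \<in> group_algebra \<iota>" using c(1)[OF w] by (simp add: associated_order_def)
      \<comment> \<open>For a = 0 and i = q - 1 the bound says that the scalar \<open>g 0\<close> is
        integral.\<close>
      from associated_order_iff[OF this g] have "fge (d (q - 1) - d (0 + (q - 1))) (g 0)"
        using c(1)[OF w] N_0[OF q1] by blast
      then have "fge (0 + (d (q - 1) + 1)) (g 0 * u (q - 1))" using u1 by (intro fge_mult) simp_all
      then show ?thesis using g u top by (intro exI[of _ "shift g u"]) (simp add: represents_def)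
    qed
    then obtain r where r: "\<And>w. c w \<noteq> Z \<Longrightarrow> act (c w) w = comb (r w)"
      "\<And>w. c w \<noteq> Z \<Longrightarrow> fge (d (q - 1) + 1) (r w (q - 1))" by metis
    have y: "y = comb (\<lambda>j. \<Sum>w | c w \<noteq> Z. r w j)" unfolding c(3) comb_sum[symmetric] using r(1) by simp
    have "t (d (q - 1)) = (\<Sum>w | c w \<noteq> Z. r w (q - 1))"
      using comb_inj[OF y[unfolded y_def] q1] by simp
    moreover have "fge (d (q - 1) + 1) (\<Sum>w | c w \<noteq> Z. r w (q - 1))" using r(2) by (intro fge_sum) auto
    ultimately have "fge (d (q - 1) + 1) (t (d (q - 1)))" by simp
    then show False by (simp add: fge_def)
  qed
  then obtain \<rho> u where \<rho>: "\<rho> \<in> B" "\<rho> = comb u" and u: "u (q - 1) \<noteq> 0" "fls_subdegree (u (q - 1)) = d (q - 1)"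
    by blast
  have B_eq: "w = \<rho>" if w: "w \<in> B" for w
  proof (rule ccontr)
    assume ne: "w \<noteq> \<rho>"
    obtain \<alpha> where \<alpha>: "\<alpha> \<in> group_algebra \<iota>" "act \<alpha> \<rho> = w" using act_surj[of u w] u \<rho> by blast
    obtain m where m: "m \<ge> 0" "(\<lambda>\<sigma>. t m * \<alpha> \<sigma>) \<in> A_L" "(\<lambda>\<sigma>. if \<sigma> = id then t m else 0) \<in> A_L"
      using associated_order_scale[OF \<alpha>(1)] by blast
    have id: "id \<in> galois_group \<iota>" by (simp add: galois_group_def field_hom_def)
    have act_id: "act (\<lambda>\<sigma>. if \<sigma> = id then t m else 0) w = \<iota> (t m) * w"
    proof -
      have "act (\<lambda>\<sigma>. if \<sigma> = id then t m else 0) w = (\<Sum>\<sigma>\<in>galois_group \<iota>. if \<sigma> = id then \<iota> (t m) * w else 0)"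
        unfolding group_algebra_act_def by (intro sum.cong) auto
      then show ?thesis using id galois_finite by simp
    qed
    have y: "\<iota> (t m) * w \<in> O_L"
      using w B m(1) ram_pos by (cases "w = 0") (auto simp: valuation_ring_def v_mult v_hom)
    have single: "R B (\<iota> (t m) * w) (\<lambda>w. if w = x then \<beta> else Z)"
      if "x \<in> B" "\<beta> \<in> A_L" "act \<beta> x = \<iota> (t m) * w" for x \<beta>
    proof -
      have "Z \<in> A_L" by (auto simp: Z_def associated_order_def group_algebra_def valuation_ring_def)
      moreover have "(\<Sum>w | (if w = x then \<beta> else Z) \<noteq> Z. act (if w = x then \<beta> else Z) w)
        = (\<Sum>w\<in>{x}. act (if w = x then \<beta> else Z) w)"
        by (intro sum.mono_neutral_left) (auto simp: Z_def split: if_splits)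
      moreover have "finite {w. (if w = x then \<beta> else Z) \<noteq> Z}"
        by (rule finite_subset[of _ "{x}"]) (auto split: if_splits)
      ultimately show ?thesis using that by (simp add: R_def)
    qed
    have act_\<alpha>: "act (\<lambda>\<sigma>. t m * \<alpha> \<sigma>) \<rho> = \<iota> (t m) * w" using \<alpha>(2) by (simp add: act_scale)
    have "R B (\<iota> (t m) * w) (\<lambda>x. if x = w then (\<lambda>\<sigma>. if \<sigma> = id then t m else 0) else Z)"
      by (rule single[OF w m(3) act_id])
    moreover have "R B (\<iota> (t m) * w) (\<lambda>x. if x = \<rho> then (\<lambda>\<sigma>. t m * \<alpha> \<sigma>) else Z)"
      by (rule single[OF \<rho>(1) m(2) act_\<alpha>])
    ultimately have eq: "(\<lambda>x. if x = w then (\<lambda>\<sigma>. if \<sigma> = id then t m else 0) else Z)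
        = (\<lambda>x. if x = \<rho> then (\<lambda>\<sigma>. t m * \<alpha> \<sigma>) else Z)" by (rule uniq[OF y])
    \<comment> \<open>At w the first coefficient function is t^m times the identity, the second is
      zero.\<close>
    from fun_cong[OF eq, of w] have "(\<lambda>\<sigma>. if \<sigma> = id then t m else 0) = Z" using ne by simp
    from fun_cong[OF this, of id] show False by (simp add: Z_def)
  qed
  have l: "a < q" using N_less[OF N] by simp
  define y where "y = comb (\<lambda>j. if j = q - 1 - a then t (d (q - 1 - a)) else 0)"
  have "y \<in> O_L" unfolding y_def comb_in_valuation_ring by (simp add: fge_def)
  then obtain c where "R B y c" using rep by blast
  then have c: "\<And>w. w \<in> B \<Longrightarrow> c w \<in> A_L" "\<And>w. w \<notin> B \<Longrightarrow> c w = Z"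
    "y = (\<Sum>w | c w \<noteq> Z. act (c w) w)" by (simp_all add: R_def)
  have "(\<Sum>w | c w \<noteq> Z. act (c w) w) = (\<Sum>w\<in>{\<rho>}. act (c w) w)"
    using c(2) B_eq by (intro sum.mono_neutral_left) (auto simp: Z_def)
  then have y: "y = act (c \<rho>) \<rho>" using c(3) by simp
  obtain g where g: "represents (c \<rho>) g" by (rule exE[OF represents_ex])
  have sh: "shift g u j = (if j = q - 1 - a then t (d (q - 1 - a)) else 0)" if "j < q" for j
  proof -
    have "act (c \<rho>) \<rho> = comb (shift g u)" using g \<rho>(2) by (simp only: represents_def)
    then have "comb (shift g u) = comb (\<lambda>j. if j = q - 1 - a then t (d (q - 1 - a)) else 0)"
      using y by (simp only: y_def)
    then show ?thesis by (rule comb_inj) (rule that)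
  qed
  \<comment> \<open>The coordinates of y above q - 1 - a vanish, so triangularity forces these
    coefficients to be zero.\<close>
  have g0: "g m = 0" if "m < a" for m
    using that
  proof (induction m rule: less_induct)
    case (less m)
    then have "shift g u (q - 1 - m) = g m * u (q - 1)" using l by (intro shift_at) auto
    then show ?case using sh[of "q - 1 - m"] less.prems l u(1) by (simp split: if_splits)
  qed
  then have "g a * u (q - 1) = t (d (q - 1 - a))"
    using shift_at[OF l, of g u] sh[of "q - 1 - a"] q by simp
  then have *: "g a \<noteq> 0" "fls_subdegree (g a * u (q - 1)) = d (q - 1 - a)" by auto
  then have "fls_subdegree (g a) + d (q - 1) = d (q - 1 - a)" using u by simp
  moreover have "fge (d i - d (a + i)) (g a)"
    using associated_order_iff[OF _ g] c(1)[OF \<rho>(1)] N by (auto simp: associated_order_def)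
  ultimately show ?thesis using * by (simp add: fge_def)
qed

end

section \<open>Artin--Schreier towers\<close>

lemma prime_CHAR_field: "CHAR('a::field) > 0 \<Longrightarrow> prime CHAR('a)"
  by (rule prime_CHAR_semidom)

lemma frobenius_add:
  fixes x y :: "'a::field"
  assumes "CHAR('a) = p" "p > 0"
  shows "(x + y) ^ p ^ k = x ^ p ^ k + y ^ p ^ k"
  using freshmans_dream'[of "p ^ k" k x y] prime_CHAR_field[where 'a = 'a] assms by simp

lemma frobenius_diff:
  fixes x y :: "'a::field"
  assumes "CHAR('a) = p" "p > 0"
  shows "(x - y) ^ p ^ k = x ^ p ^ k - y ^ p ^ k"
  using frobenius_add[OF assms, of "x - y" y k] by (simp add: algebra_simps)

lemma frobenius_diff1:
  fixes x y :: "'a::field"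
  assumes "CHAR('a) = p" "p > 0"
  shows "(x - y) ^ p = x ^ p - y ^ p"
  using frobenius_diff[OF assms, of x y 1] by simp

lemma of_nat_power_CHAR:
  assumes "CHAR('a::field) = p" "p > 0"
  shows "(of_nat c :: 'a) ^ p = of_nat c"
proof (induction c)
  case (Suc c)
  then show ?case using frobenius_add[OF assms, of "of_nat c" 1 1] by (simp add: add.commute)
qed (use assms in auto)

lemma of_nat_less_CHAR:
  assumes "CHAR('a::field) = p" "c < p" "c' < p" "(of_nat c :: 'a) = of_nat c'"
  shows "c = c'"
proof -
  have "[c = c'] (mod p)" using assms by (simp add: of_nat_eq_iff_cong_CHAR)
  then show ?thesis using assms by (simp add: cong_less_modulus_unique_nat)
qed

text \<open>For z \<noteq> 0, dividing by z^p reduces this to Y^p - Y, whose roots are the elements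
  of the prime field.\<close>

lemma artin_schreier_factorization:
  fixes y z :: "'a::field"
  assumes "CHAR('a) = p" "p > 0"
  shows "y ^ p - z ^ (p - 1) * y = (\<Prod>c<p. y - of_nat c * z)"
proof (cases "z = 0")
  case True
  have "p > 1" using prime_CHAR_field[where 'a = 'a] assms by (auto dest: prime_gt_1_nat)
  then show ?thesis using True by simp
next
  case False
  have p: "p > 1" using prime_CHAR_field[where 'a = 'a] assms by (auto dest: prime_gt_1_nat)
  define P where "P = (monom 1 p - monom 1 1 :: 'a poly)"
  define Q where "Q = (\<Prod>c<p. [:- of_nat c, 1:] :: 'a poly)"
  define A where "A = (of_nat ` {..<p} :: 'a set)"
  have A: "card A = p"
    unfolding A_def using of_nat_less_CHAR[OF assms(1)] by (subst card_image) (auto intro!: inj_onI)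
  have degQ: "degree Q = p" unfolding Q_def by (subst degree_prod_eq_sum_degree) auto
  have degP: "degree P = p" unfolding P_def
    using p by (subst diff_conv_add_uminus, subst degree_add_eq_left)
      (auto simp: degree_monom_eq)
  have "P = Q"
  proof (rule poly_eqI_degree_lead_coeff[where n = p and A = A])
    show "coeff P p = coeff Q p"
    proof -
      have "lead_coeff Q = 1" unfolding Q_def by (subst lead_coeff_prod) simp
      then show ?thesis using degQ p by (simp add: P_def)
    qed
    show "poly P x = poly Q x" if x: "x \<in> A" for x
    proof -
      obtain c where c: "c < p" "x = of_nat c" using x by (auto simp: A_def)
      have "poly Q x = 0" unfolding Q_def poly_prod using c by (intro prod_zero) auto
      moreover have "poly P x = 0"
        using of_nat_power_CHAR[OF assms, of c] c by (simp add: P_def poly_monom)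
      ultimately show ?thesis by simp
    qed
  qed (use A degP degQ in auto)
  then have "poly P (y / z) = poly Q (y / z)" by simp
  then have *: "(y / z) ^ p - y / z = (\<Prod>c<p. y / z - of_nat c)"
    unfolding P_def Q_def poly_prod by (simp add: poly_monom)
  have "y ^ p - z ^ (p - 1) * y = z ^ p * ((y / z) ^ p - y / z)"
  proof -
    have "z ^ p = z * z ^ (p - 1)" using assms(2) by (simp flip: power_Suc)
    then show ?thesis using False by (simp add: field_simps power_divide)
  qed
  also have "\<dots> = (\<Prod>c<p. z * (y / z - of_nat c))"
    unfolding * prod.distrib by simp
  also have "\<dots> = (\<Prod>c<p. y - of_nat c * z)"
    using False by (intro prod.cong) (auto simp: field_simps)
  finally show ?thesis .
qed

text \<open>\<open>span_poly p \<Omega> i\<close> is the monic additive polynomial whose roots form the \<open>\<F>\<^sub>p\<close>-span of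
  \<open>\<Omega>\<^sub>0, \<dots>, \<Omega>\<^sub>i\<^sub>-\<^sub>1\<close>.\<close>

fun span_poly :: "nat \<Rightarrow> (nat \<Rightarrow> 'a::field) \<Rightarrow> nat \<Rightarrow> 'a \<Rightarrow> 'a" where
  "span_poly p \<Omega> 0 y = y"
| "span_poly p \<Omega> (Suc i) y = span_poly p \<Omega> i y ^ p - span_poly p \<Omega> i (\<Omega> i) ^ (p - 1) * span_poly p \<Omega> i y"

lemma span_poly_diff:
  assumes "CHAR('a::field) = p" "p > 0"
  shows "span_poly p \<Omega> i (y - z :: 'a) = span_poly p \<Omega> i y - span_poly p \<Omega> i z"
proof (induction i)
  case (Suc i)
  show ?case unfolding span_poly.simps Suc frobenius_diff1[OF assms] by (simp add: algebra_simps)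
qed simp

lemma span_poly_of_nat:
  assumes "CHAR('a::field) = p" "p > 0"
  shows "span_poly p \<Omega> i (of_nat c * y :: 'a) = of_nat c * span_poly p \<Omega> i y"
proof (induction c)
  case 0
  show ?case using span_poly_diff[OF assms, of \<Omega> i 0 0] by simp
next
  case (Suc c)
  have "span_poly p \<Omega> i y = span_poly p \<Omega> i (of_nat (Suc c) * y) - span_poly p \<Omega> i (of_nat c * y)"
    by (subst span_poly_diff[OF assms, symmetric]) (simp add: algebra_simps)
  then show ?case using Suc by (simp add: algebra_simps)
qed

text \<open>The Artin-Schreier factorization at the values of the previous polynomial, combined with
  additivity. Valuations can be computed from the product form.\<close>

lemma span_poly_Suc_prod:
  assumes "CHAR('a::field) = p" "p > 0"
  shows "span_poly p \<Omega> (Suc i) (y :: 'a) = (\<Prod>c<p. span_poly p \<Omega> i (y - of_nat c * \<Omega> i))"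
  unfolding span_poly.simps artin_schreier_factorization[OF assms] span_poly_diff[OF assms]
    span_poly_of_nat[OF assms] ..

text \<open>The bound on the \<epsilon>_i contains the fraction (p^n - 1) b / p^n, hence strict
  inequalities with real right-hand sides.\<close>

definition fgt :: "real \<Rightarrow> 'k::field fls \<Rightarrow> bool" where
  "fgt r z \<longleftrightarrow> z = 0 \<or> real_of_int (fls_subdegree z) > r"

lemma fgt_mult: "fgt r z \<Longrightarrow> u \<noteq> 0 \<Longrightarrow> fgt (real_of_int (fls_subdegree u) + r) (u * z)"
  by (cases "z = 0") (auto simp: fgt_def)

lemma fgt_diff: "fgt r y \<Longrightarrow> fgt r z \<Longrightarrow> fgt r (y - z)"
  unfolding fgt_def using fls_plus_subdegree[of y "- z"]
  by (cases "y = 0 \<or> z = 0 \<or> y = z") auto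

section \<open>Valuations of the elimination coefficients\<close>

locale near_one_dim_data = valued_extension \<iota> v
  for \<iota> :: "'k::field fls \<Rightarrow> 'l::field" and v +
  fixes p n b :: nat and \<beta> :: "'k fls" and \<Omega> \<epsilon> :: "nat \<Rightarrow> 'k fls"
  assumes CHAR: "CHAR('k) = p" and p_pos: "p > 0"
    and \<beta>: "fls_subdegree \<beta> = - int b" and b_pos: "b > 0" and coprime: "coprime b p"
    and \<Omega>_0: "\<Omega> 0 = 1" and \<Omega>_nz: "\<And>i. i \<le> n \<Longrightarrow> \<Omega> i \<noteq> 0"
    and \<Omega>_mono: "\<And>i. i < n \<Longrightarrow> fls_subdegree (\<Omega> (Suc i)) \<le> fls_subdegree (\<Omega> i)"
    and \<Omega>_indep: "\<And>i j a. i < j \<Longrightarrow> j \<le> n \<Longrightarrow>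
        (\<forall>s\<in>{i..j}. fls_subdegree (\<Omega> s) = fls_subdegree (\<Omega> i)) \<Longrightarrow>
        (\<Sum>s=i..j. of_int (a s) * \<Omega> s) \<in> (\<lambda>z. \<Omega> i * z) ` maximal_ideal fls_subdegree \<Longrightarrow>
        \<forall>s\<in>{i..j}. int p dvd a s"
    and \<epsilon>: "\<And>i. i \<le> n \<Longrightarrow> \<epsilon> i \<noteq> 0 \<Longrightarrow>
        real_of_int (fls_subdegree (\<epsilon> i)) >
          real_of_int (fls_subdegree (\<Omega> i ^ (p ^ n) * \<beta>))
          + (real p ^ n - 1) * real b / real p ^ n
          - (real p - 1) * (\<Sum>j=1..<n. real p ^ j * real_of_int (fls_subdegree (\<Omega> j)))"
begin

lemma prime_p: "prime p"
  using prime_CHAR_field[where 'a = 'k] CHAR p_pos by simp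

lemma p_gt_1: "p > 1"
  using prime_p by (rule prime_gt_1_nat)

lemma CHAR_K: "CHAR('k fls) = p"
  by (simp add: CHAR)

lemma CHAR_L: "CHAR('l) = p"
proof (rule CHAR_eqI)
  show "of_nat p = (0 :: 'l)"
    using hom_of_nat[of p] CHAR_K by (metis hom_0 of_nat_CHAR)
  fix c assume "of_nat c = (0 :: 'l)"
  then have "of_nat c = (0 :: 'k fls)" using hom_of_nat[of c] by (metis hom_eq_0_iff)
  then show "p dvd c" using CHAR_K by (simp add: of_nat_eq_0_iff_char_dvd)
qed

lemma \<beta>_nz: "\<beta> \<noteq> 0"
  using \<beta> b_pos by auto

definition m :: "nat \<Rightarrow> int" where "m j = - fls_subdegree (\<Omega> j)"

lemma m_0 [simp]: "m 0 = 0"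
  by (simp add: m_def \<Omega>_0)

lemma m_mono: "i \<le> j \<Longrightarrow> j \<le> n \<Longrightarrow> m i \<le> m j"
proof (induction j rule: dec_induct)
  case (step j)
  then show ?case using \<Omega>_mono[of j] by (auto simp: m_def)
qed simp

lemma of_int_K_nz: "\<not> int p dvd c \<Longrightarrow> (of_int c :: 'k fls) \<noteq> 0"
  by (metis CHAR_K of_int_eq_0_iff_char_dvd)

text \<open>Only the block of \<Omega>_s with the same valuation as \<Omega>_j matters, since
  earlier terms have larger valuation. Within the block, independence over F_p prevents cancellation
  because a_j is nonzero modulo p.\<close>

lemma leading_combination:
  assumes j: "j \<le> n" and a: "\<not> int p dvd a j"
  shows "(\<Sum>s\<le>j. of_int (a s) * \<Omega> s) \<noteq> 0 \<and> fls_subdegree (\<Sum>s\<le>j. of_int (a s) * \<Omega> s) = - m j"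
proof -
  define i where "i = (LEAST i. m i = m j)"
  have mi: "m i = m j" unfolding i_def by (rule LeastI[of _ j]) simp
  have ij: "i \<le> j" unfolding i_def by (rule Least_le) simp
  have below: "m s < m j" if "s < i" for s
    using not_less_Least[of s "\<lambda>i. m i = m j"] that m_mono[of s j] j ij unfolding i_def[symmetric]
    by force
  have block: "m s = m j" if "s \<in> {i..j}" for s
    using m_mono[of i s] m_mono[of s j] mi that j by auto
  define u where "u = (\<Sum>s=i..j. of_int (a s) * \<Omega> s)"
  have u: "u \<noteq> 0 \<and> fls_subdegree u = - m j"
  proof (cases "i = j")
    case True
    then show ?thesis using of_int_K_nz[OF a] \<Omega>_nz[OF j] by (simp add: u_def m_def)
  next
    case False
    then have lt: "i < j" using ij le_neq_implies_less by blast
    have eq: "\<forall>s\<in>{i..j}. fls_subdegree (\<Omega> s) = fls_subdegree (\<Omega> i)"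
    proof (rule ballI)
      fix s assume "s \<in> {i..j}"
      then have "m s = m i" unfolding mi by (rule block)
      then show "fls_subdegree (\<Omega> s) = fls_subdegree (\<Omega> i)" by (simp add: m_def)
    qed
    have *: "u \<notin> (\<lambda>z. \<Omega> i * z) ` maximal_ideal fls_subdegree"
    proof
      assume "u \<in> (\<lambda>z. \<Omega> i * z) ` maximal_ideal fls_subdegree"
      then have "\<forall>s\<in>{i..j}. int p dvd a s" unfolding u_def by (rule \<Omega>_indep[OF lt j eq])
      then show False using a ij by simp
    qed
    have \<Omega>i: "\<Omega> i \<noteq> 0" using \<Omega>_nz ij j by simp
    have u0: "u \<noteq> 0"
    proof
      assume "u = 0"
      then have "u = \<Omega> i * 0" by simp
      then show False using * by (force simp: maximal_ideal_def)
    qed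
    have le: "fls_subdegree u \<le> - m j"
    proof (rule ccontr)
      assume "\<not> ?thesis"
      then have "fls_subdegree (u / \<Omega> i) > 0"
        using u0 \<Omega>i mi fls_subdegree_mult[of "u / \<Omega> i" "\<Omega> i"] by (simp add: m_def)
      then have "u / \<Omega> i \<in> maximal_ideal fls_subdegree" by (simp add: maximal_ideal_def)
      then have "\<Omega> i * (u / \<Omega> i) \<in> (\<lambda>z. \<Omega> i * z) ` maximal_ideal fls_subdegree" by (rule imageI)
      then show False using * \<Omega>i by simp
    qed
    have "fge (- m j) u"
      unfolding u_def
    proof (rule fge_sum)
      fix s assume "s \<in> {i..j}"
      then have "fge (0 + - m j) (of_int (a s) * \<Omega> s)"
        using block[of s] by (intro fge_mult) (auto simp: fge_def m_def)
      then show "fge (- m j) (of_int (a s) * \<Omega> s)" by simp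
    qed
    then show ?thesis using le u0 by (auto simp: fge_def)
  qed
  have r: "fge (- m j + 1) (\<Sum>s<i. of_int (a s) * \<Omega> s)"
  proof (rule fge_sum)
    fix s assume "s \<in> {..<i}"
    then have "fge (0 + (- m j + 1)) (of_int (a s) * \<Omega> s)"
      using below[of s] by (intro fge_mult) (auto simp: fge_def m_def)
    then show "fge (- m j + 1) (of_int (a s) * \<Omega> s)" by simp
  qed
  have "(\<Sum>s\<le>j. of_int (a s) * \<Omega> s) = (\<Sum>s<i. of_int (a s) * \<Omega> s) + u"
  proof -
    have "{..j} = {..<i} \<union> {i..j}" using ij by auto
    then show ?thesis unfolding u_def by (simp add: sum.union_disjoint ivl_disj_int)
  qed
  also have "\<dots> \<noteq> 0 \<and> fls_subdegree \<dots> = - m j"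
  proof (cases "(\<Sum>s<i. of_int (a s) * \<Omega> s) = 0")
    case False
    then have lt: "fls_subdegree u < fls_subdegree (\<Sum>s<i. of_int (a s) * \<Omega> s)"
      using r u by (simp add: fge_def)
    then have "fls_subdegree ((\<Sum>s<i. of_int (a s) * \<Omega> s) + u) = fls_subdegree u"
      using u by (intro fls_subdegree_add_eq2) auto
    moreover have "(\<Sum>s<i. of_int (a s) * \<Omega> s) + u \<noteq> 0"
      using lt by (metis add_eq_0_iff fls_uminus_subdegree less_irrefl)
    ultimately show ?thesis using u by simp
  qed (use u in simp)
  finally show ?thesis .
qed

text \<open>The product formula passes to the p translates u - c \<Omega>_i. For i < j these are
  combinations with the same coefficient at j, so all p factors have equal valuation and each step
  multiplies it by p. The induction therefore runs over all coefficient vectors.\<close>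

lemma span_poly_subdegree:
  assumes "i \<le> j" "j \<le> n" "\<not> int p dvd a j"
  defines "u \<equiv> \<lambda>a :: nat \<Rightarrow> int. \<Sum>s\<le>j. of_int (a s) * \<Omega> s"
  shows "span_poly p \<Omega> i (u a) \<noteq> 0 \<and> fls_subdegree (span_poly p \<Omega> i (u a)) = - (int p ^ i * m j)"
  using assms(1,3)
proof (induction i arbitrary: a)
  case 0
  then show ?case using leading_combination[OF assms(2)] by (simp add: u_def)
next
  case (Suc i)
  have ih: "span_poly p \<Omega> i (u a - of_nat c * \<Omega> i) \<noteq> 0 \<and>
    fls_subdegree (span_poly p \<Omega> i (u a - of_nat c * \<Omega> i)) = - (int p ^ i * m j)" for c
  proof -
    have "u a - of_nat c * \<Omega> i = u (a(i := a i - int c))"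
    proof -
      have 1: "u f = of_int (f i) * \<Omega> i + (\<Sum>s\<in>{..j}-{i}. of_int (f s) * \<Omega> s)" for f
        unfolding u_def using Suc.prems by (intro sum.remove) auto
      show ?thesis unfolding 1[of a] 1[of "a(i := a i - int c)"]
        by (simp add: algebra_simps)
    qed
    moreover have "i \<le> j" "\<not> int p dvd (a(i := a i - int c)) j" using Suc.prems by auto
    then have "span_poly p \<Omega> i (u (a(i := a i - int c))) \<noteq> 0 \<and>
        fls_subdegree (span_poly p \<Omega> i (u (a(i := a i - int c)))) = - (int p ^ i * m j)"
      by (rule Suc.IH)
    ultimately show ?thesis by (simp only: simp_thms)
  qed
  have "fls_subdegree (\<Prod>c<k. span_poly p \<Omega> i (u a - of_nat c * \<Omega> i)) = - (int k * int p ^ i * m j)" for k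
  proof (induction k)
    case (Suc k)
    have "(\<Prod>c<k. span_poly p \<Omega> i (u a - of_nat c * \<Omega> i)) \<noteq> 0" using ih by simp
    then show ?case using Suc ih[of k] by (simp add: algebra_simps)
  qed simp
  then show ?case
    unfolding span_poly_Suc_prod[OF CHAR_K p_pos] using ih by (simp add: algebra_simps)
qed

definition D :: "nat \<Rightarrow> nat \<Rightarrow> 'k fls" where "D i j = span_poly p \<Omega> i (\<Omega> j)"

lemma D_0 [simp]: "D 0 j = \<Omega> j"
  by (simp add: D_def)

lemma D_Suc: "D (Suc i) j = D i j ^ p - D i i ^ (p - 1) * D i j"
  by (simp add: D_def)

lemma D_nz: "i \<le> j \<Longrightarrow> j \<le> n \<Longrightarrow> D i j \<noteq> 0"
  and D_subdegree: "i \<le> j \<Longrightarrow> j \<le> n \<Longrightarrow> fls_subdegree (D i j) = - (int p ^ i * m j)"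
proof -
  define a where "a = (\<lambda>s. if s = j then 1 else 0 :: int)"
  have a: "(\<Sum>s\<le>j. of_int (a s) * \<Omega> s) = \<Omega> j"
    by (subst sum.mono_neutral_right[where S = "{j}"]) (auto simp: a_def)
  have "\<not> int p dvd a j" using p_gt_1 by (simp add: a_def)
  then show "D i j \<noteq> 0" "fls_subdegree (D i j) = - (int p ^ i * m j)" if "i \<le> j" "j \<le> n"
    using span_poly_subdegree[OF that, of a] unfolding a D_def by auto
qed

section \<open>Elimination in the Artin-Schreier equations\<close>

primrec tower :: "(nat \<Rightarrow> 'l) \<Rightarrow> nat \<Rightarrow> nat \<Rightarrow> 'l" where
  "tower x 0 j = x j"
| "tower x (Suc i) j = tower x i j - \<iota> ((D i j / D i i) ^ p ^ (n - Suc i)) * tower x i i"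

primrec err :: "nat \<Rightarrow> nat \<Rightarrow> 'k fls" where
  "err 0 j = \<epsilon> j"
| "err (Suc i) j = err i j - (D i j / D i i) ^ p ^ (n - i) * err i i"

text \<open>The leading factor of the equations at level i, the same for every j, which makes
  elimination possible. From level 1 on it is the previous tower element up to a factor in K, so
  each valuation determines the next.\<close>

definition top_coeff :: "(nat \<Rightarrow> 'l) \<Rightarrow> nat \<Rightarrow> 'l" where
  "top_coeff x i = (case i of 0 \<Rightarrow> \<iota> \<beta> | Suc k \<Rightarrow> - tower x k k / \<iota> (D k k ^ p ^ (n - k)))"

definition artin_schreier_roots :: "(nat \<Rightarrow> 'l) \<Rightarrow> bool" where
  "artin_schreier_roots x \<longleftrightarrow> (\<forall>i\<le>n. x i ^ p - x i = \<iota> (\<Omega> i ^ (p ^ n) * \<beta> + \<epsilon> i))"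

text \<open>Eliminating \<open>tower x i i\<close> from the equations at level \<open>i\<close> leaves equations of the same shape.\<close>

lemma tower_equation:
  assumes x: "artin_schreier_roots x" and "i \<le> j" "j \<le> n"
  shows "tower x i j ^ p = tower x i j + top_coeff x i * \<iota> (D i j ^ p ^ (n - i)) + \<iota> (err i j)"
  using assms(2,3)
proof (induction i arbitrary: j)
  case 0
  then have "x j ^ p - x j = \<iota> (\<Omega> j ^ (p ^ n) * \<beta> + \<epsilon> j)" using x by (simp add: artin_schreier_roots_def)
  then show ?case by (simp add: top_coeff_def hom_add hom_mult algebra_simps)
next
  case (Suc i)
  define k where "k = n - Suc i"
  have nk: "n - i = Suc k" using Suc.prems by (simp add: k_def)
  define r where "r = D i j / D i i"
  have Dii: "D i i \<noteq> 0" using D_nz Suc.prems by simp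
  have rD: "D i j = r * D i i" using Dii by (simp add: r_def)
  have DS: "D (Suc i) j = (r ^ p - r) * D i i ^ p"
  proof -
    have "D i i ^ p = D i i ^ (p - 1) * D i i" using p_pos by (simp flip: power_Suc2)
    then show ?thesis unfolding D_Suc rD by (simp add: power_mult_distrib algebra_simps)
  qed
  have e: "(\<iota> z ^ p ^ k) ^ p = \<iota> z ^ p ^ Suc k" for z
    by (simp add: power_mult[symmetric] mult.commute)
  define y where "y = tower x i i"
  define g where "g = top_coeff x i"
  have yj: "tower x i j ^ p = tower x i j + g * \<iota> (D i j ^ p ^ Suc k) + \<iota> (err i j)"
    using Suc.IH[of j] Suc.prems nk by (simp add: g_def)
  have yi: "y ^ p = y + g * \<iota> (D i i ^ p ^ Suc k) + \<iota> (err i i)"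
    using Suc.IH[of i] Suc.prems nk by (simp add: g_def y_def)
  have "tower x (Suc i) j ^ p = tower x i j ^ p - \<iota> (r ^ p ^ Suc k) * y ^ p"
    unfolding tower.simps r_def[symmetric] k_def[symmetric] y_def[symmetric]
      frobenius_diff1[OF CHAR_L p_pos] power_mult_distrib hom_power e ..
  \<comment> \<open>The leading terms cancel because D_ij = r D_ii.\<close>
  also have "\<dots> = tower x i j - \<iota> (r ^ p ^ Suc k) * y + \<iota> (err i j) - \<iota> (r ^ p ^ Suc k) * \<iota> (err i i)"
    unfolding yi yj rD power_mult_distrib by (simp add: hom_mult algebra_simps)
  \<comment> \<open>The new tower element contains r^(p^k), whereas the p-th power produced
    r^(p^(k+1)). The difference times y is the leading term of the next level, since D_(i+1)j = (r^p
    - r) D_ii^p.\<close>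
  also have "\<dots> = tower x (Suc i) j - y * \<iota> (r ^ p ^ Suc k - r ^ p ^ k) + \<iota> (err (Suc i) j)"
    unfolding tower.simps err.simps r_def[symmetric] k_def[symmetric] y_def[symmetric] nk
    by (simp add: hom_diff hom_mult algebra_simps)
  also have "y * \<iota> (r ^ p ^ Suc k - r ^ p ^ k) = - (top_coeff x (Suc i) * \<iota> (D (Suc i) j ^ p ^ k))"
  proof -
    have "(r ^ p - r) ^ p ^ k = r ^ p ^ Suc k - r ^ p ^ k"
      unfolding frobenius_diff[OF CHAR_K p_pos] by (simp add: power_mult[symmetric])
    moreover have "(D i i ^ p) ^ p ^ k = D i i ^ p ^ Suc k" by (simp add: power_mult[symmetric])
    ultimately have "D (Suc i) j ^ p ^ k = (r ^ p ^ Suc k - r ^ p ^ k) * D i i ^ p ^ Suc k"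
      unfolding DS power_mult_distrib by simp
    then show ?thesis using Dii
      by (simp add: top_coeff_def nk y_def hom_mult hom_power)
  qed
  finally show ?case by (simp add: k_def)
qed

text \<open>The part of the bound on \<epsilon>_i that does not depend on i: the -b from \<beta> and
  (p^n - 1) b / p^n combine to - b / p^n. The sum may start at s = 0 because m 0 = 0.\<close>

definition C :: real where
  "C = - (real b / real p ^ n) + (real p - 1) * (\<Sum>s<n. real p ^ s * real_of_int (m s))"

text \<open>The multiplier of \<open>err i i\<close> has valuation p^n (m_i - m_j), as p^i and
  p^(n-i) combine. It carries the bound for index i exactly to the one for j.\<close>

lemma err_bound:
  assumes "i \<le> j" "j \<le> n"
  shows "fgt (C - real p ^ n * real_of_int (m j)) (err i j)"
  using assms
proof (induction i arbitrary: j)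
  case 0
  have *: "(\<Sum>s=1..<n. real p ^ s * real_of_int (fls_subdegree (\<Omega> s))) = - (\<Sum>s<n. real p ^ s * real_of_int (m s))"
  proof -
    have "(\<Sum>s<n. real p ^ s * real_of_int (m s)) = (\<Sum>s=1..<n. real p ^ s * real_of_int (m s))"
      by (intro sum.mono_neutral_right) (auto simp: Suc_le_eq)
    then show ?thesis by (simp add: m_def sum_negf)
  qed
  have "fls_subdegree (\<Omega> j ^ (p ^ n) * \<beta>) = - (int p ^ n * m j) - int b"
    using \<Omega>_nz[of j] 0 \<beta>_nz \<beta> by (simp add: fls_subdegree_pow m_def)
  then have "real_of_int (fls_subdegree (\<Omega> j ^ (p ^ n) * \<beta>)) = - (real p ^ n * m j) - real b" by simp
  then have "fls_subdegree (\<Omega> j ^ (p ^ n) * \<beta>) + (real p ^ n - 1) * real b / real p ^ n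
          - (real p - 1) * (\<Sum>s=1..<n. real p ^ s * real_of_int (fls_subdegree (\<Omega> s)))
      = C - real p ^ n * real_of_int (m j)"
    unfolding * C_def using p_pos by (simp only:) (simp add: field_simps)
  then show ?case using \<epsilon>[of j] 0 by (auto simp: fgt_def)
next
  case (Suc i)
  have nz: "D i j \<noteq> 0" "D i i \<noteq> 0" using D_nz Suc.prems by auto
  have "fls_subdegree ((D i j / D i i) ^ p ^ (n - i)) = int p ^ (n - i) * (- (int p ^ i * m j) + int p ^ i * m i)"
    using nz D_subdegree[of i j] D_subdegree[of i i] Suc.prems fls_subdegree_mult[of "D i j / D i i" "D i i"]
    by (simp add: fls_subdegree_pow)
  also have "\<dots> = (int p ^ (n - i) * int p ^ i) * (m i - m j)" by (simp add: algebra_simps)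
  also have "int p ^ (n - i) * int p ^ i = int p ^ n" using Suc.prems by (simp flip: power_add)
  finally have *: "real_of_int (fls_subdegree ((D i j / D i i) ^ p ^ (n - i))) = real p ^ n * real_of_int (m i - m j)"
    by simp
  have "fgt (real p ^ n * real_of_int (m i - m j) + (C - real p ^ n * real_of_int (m i)))
      ((D i j / D i i) ^ p ^ (n - i) * err i i)"
    unfolding *[symmetric] using Suc.IH[of i] Suc.prems nz by (intro fgt_mult) auto
  moreover have "real p ^ n * real_of_int (m i - m j) + (C - real p ^ n * real_of_int (m i)) = C - real p ^ n * real_of_int (m j)"
    by (simp add: algebra_simps)
  ultimately have "fgt (C - real p ^ n * real_of_int (m j)) ((D i j / D i i) ^ p ^ (n - i) * err i i)"
    by (simp only:)
  then show ?case using Suc.IH[of j] Suc.prems by (auto intro: fgt_diff)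
qed


text \<open>\<open>b + p\<^sup>n L\<^sub>i\<close> are the lower ramification numbers \<open>b\<^sub>(\<^sub>i\<^sub>)\<close> of the extension.\<close>

definition L :: "nat \<Rightarrow> int" where
  "L i = int p ^ i * m i - (int p - 1) * (\<Sum>s<i. int p ^ s * m s)"

lemma L_0 [simp]: "L 0 = 0"
  by (simp add: L_def)

lemma L_Suc: "L (Suc i) = L i + int p ^ Suc i * (m (Suc i) - m i)"
  by (simp add: L_def algebra_simps)

lemma L_nonneg: "i \<le> n \<Longrightarrow> L i \<ge> 0"
proof (induction i)
  case (Suc i)
  then show ?case using m_mono[of i "Suc i"] unfolding L_Suc by simp
qed simp

lemma p_dvd_L: "int p dvd L i"
  by (induction i) (auto simp: L_Suc)

text \<open>A nonnegative v y would make c integral. So v y < 0, and y^p strictly dominates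
  y.\<close>

lemma artin_schreier_valuation:
  assumes "y ^ p - y = c" "c \<noteq> 0" "v c < 0"
  shows "y \<noteq> 0" "int p * v y = v c"
proof -
  show y: "y \<noteq> 0" using assms p_pos by auto
  have vy: "v y < 0"
  proof (rule ccontr)
    assume "\<not> ?thesis"
    then have "v y \<ge> 0" by simp
    then have "vge 0 (y ^ p)" "vge 0 y" using y by (simp_all add: vge_def v_power)
    then have "vge 0 c" using assms(1) vge_diff by blast
    then show False using assms by (simp add: vge_def)
  qed
  have "v (y ^ p) = int p * v y" using y by (simp add: v_power)
  moreover have "int p * v y < v y" using vy p_gt_1 by simp
  ultimately have "vge (v (y ^ p) + 1) (- y)" using y by (simp add: vge_def)
  then have "v (y ^ p + - y) = v (y ^ p)" using y by (intro v_add_dominant) auto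
  then show "int p * v y = v c" using assms(1) y by (simp add: v_power)
qed

text \<open>\<open>E i\<close> is non-increasing: from k to k + 1 the jump of L cancels the change
  in m, leaving only a division by p. Since E n = - C, the error bound is sufficient at every
  level.\<close>

lemma C_le:
  assumes "i \<le> n"
  shows "C - real p ^ n * real_of_int (m i) \<ge> - real_of_int (int b + int p ^ n * L i) / real p ^ i"
proof -
  define E where "E = (\<lambda>i. real_of_int (int b + int p ^ n * L i) / real p ^ i - real p ^ n * real_of_int (m i))"
  have p0: "real p > 0" using p_pos by simp
  have decr: "E (Suc k) \<le> E k" if "k < n" for k
  proof -
    have "E (Suc k) = real_of_int (int b + int p ^ n * L k) / real p ^ Suc k - real p ^ n * real_of_int (m k)"
      using p0 by (simp add: E_def L_Suc field_simps)
    also have "real_of_int (int b + int p ^ n * L k) / real p ^ Suc k \<le> real_of_int (int b + int p ^ n * L k) / real p ^ k"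
    proof (rule divide_left_mono)
      have "real p ^ k * 1 \<le> real p ^ k * real p" using p_gt_1 by (intro mult_left_mono) auto
      then show "real p ^ k \<le> real p ^ Suc k" by (simp add: mult.commute)
      show "0 \<le> real_of_int (int b + int p ^ n * L k)" using L_nonneg[of k] that by (simp only: of_int_0_le_iff) simp
    qed (use p0 in simp)
    finally show ?thesis by (simp add: E_def)
  qed
  have "E j \<le> E i" if "i \<le> j" "j \<le> n" for j
    using that
  proof (induction j rule: dec_induct)
    case (step j)
    then show ?case using decr[of j] by simp
  qed simp
  then have "E n \<le> E i" using assms by simp
  moreover have "E n = - C"
    using p0 by (simp add: E_def C_def L_def field_simps)
  ultimately have "- C \<le> E i" by (simp only:)
  then show ?thesis by (simp only: E_def minus_divide_left[symmetric])
qed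

text \<open>By \<open>err_bound\<close> and \<open>C_le\<close> the leading term c dominates the
  error, so \<open>artin_schreier_valuation\<close> applies. Here \<open>ram\<close> stays symbolic,
  because total ramification is deduced only from the resulting valuations.\<close>

lemma tower_valuation_step:
  assumes x: "artin_schreier_roots x" and i: "i \<le> n"
  defines "c \<equiv> top_coeff x i * \<iota> (D i i ^ p ^ (n - i))"
  assumes c: "c \<noteq> 0" "int p ^ i * v c = - (ram * (int b + int p ^ n * L i))"
  shows "tower x i i \<noteq> 0 \<and> int p ^ Suc i * v (tower x i i) = - (ram * (int b + int p ^ n * L i))"
proof -
  define R where "R = int b + int p ^ n * L i"
  have R: "R > 0" unfolding R_def using b_pos L_nonneg[OF i] by (intro add_pos_nonneg) auto
  have pi: "int p ^ i > 0" using p_pos by simp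
  have eq: "tower x i i ^ p - tower x i i = c + \<iota> (err i i)"
    using tower_equation[OF x order_refl i] by (simp add: c_def)
  have e: "vge (v c + 1) (\<iota> (err i i))"
  proof (cases "err i i = 0")
    case False
    then have "- real_of_int R / real p ^ i < real_of_int (fls_subdegree (err i i))"
      using err_bound[OF order_refl i] C_le[OF i] by (simp add: fgt_def R_def)
    then have "- real_of_int R / real p ^ i * real p ^ i < real_of_int (fls_subdegree (err i i)) * real p ^ i"
      using p_pos by (intro mult_strict_right_mono) auto
    then have "- real_of_int R < real_of_int (int p ^ i * fls_subdegree (err i i))"
      using p_pos by (simp add: mult.commute)
    then have "- R < int p ^ i * fls_subdegree (err i i)" by linarith
    then have "ram * (- R) < ram * (int p ^ i * fls_subdegree (err i i))"
      using ram_pos by (intro mult_strict_left_mono)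
    then have "int p ^ i * v c < int p ^ i * v (\<iota> (err i i))"
      using False c(2) by (simp add: v_hom R_def algebra_simps)
    then show ?thesis using pi by (simp add: vge_def)
  qed simp
  have nz: "c + \<iota> (err i i) \<noteq> 0" and vc: "v (c + \<iota> (err i i)) = v c"
    using v_add_dominant[OF c(1) e] by auto
  have "int p ^ i * v c < 0" using c(2) R ram_pos by (simp add: R_def)
  then have "v c < 0" using pi by (simp add: mult_less_0_iff)
  then have "tower x i i \<noteq> 0" "int p * v (tower x i i) = v c"
    using artin_schreier_valuation[OF eq nz] vc by auto
  then show ?thesis using c(2) by (metis mult.assoc mult.commute power_Suc)
qed

text \<open>At level i + 1 the leading term is the previous tower element times an element of K of
  valuation - p^n (m_(i+1) - m_i). Scaled by p^(i+1), this is the increment in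
  \<open>L_Suc\<close>.\<close>

lemma tower_valuation:
  assumes x: "artin_schreier_roots x" and "i \<le> n"
  shows "tower x i i \<noteq> 0 \<and> int p ^ Suc i * v (tower x i i) = - (ram * (int b + int p ^ n * L i))"
  using assms(2)
proof (induction i)
  case 0
  show ?case
    using \<beta>_nz \<beta> by (intro tower_valuation_step[OF x]) (auto simp: top_coeff_def \<Omega>_0 v_hom)
next
  case (Suc i)
  have X: "tower x i i \<noteq> 0" "int p ^ Suc i * v (tower x i i) = - (ram * (int b + int p ^ n * L i))"
    using Suc by auto
  have nz: "D i i \<noteq> 0" "D (Suc i) (Suc i) \<noteq> 0" using D_nz Suc.prems by auto
  define k where "k = n - Suc i"
  have k: "n - i = Suc k" "n = k + Suc i" using Suc.prems by (auto simp: k_def)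
  define c where "c = top_coeff x (Suc i) * \<iota> (D (Suc i) (Suc i) ^ p ^ k)"
  have c_nz: "c \<noteq> 0" using X(1) nz by (simp add: c_def top_coeff_def)
  have "v c = v (tower x i i) - ram * (int p ^ Suc k * (- (int p ^ i * m i)))
      + ram * (int p ^ k * (- (int p ^ Suc i * m (Suc i))))"
    unfolding c_def top_coeff_def nat.case k(1) using X(1) nz Suc.prems
    by (simp add: v_mult v_divide v_hom fls_subdegree_pow D_subdegree)
  also have "\<dots> = v (tower x i i) - ram * int p ^ n * (m (Suc i) - m i)"
    unfolding k(2) power_add by (simp add: algebra_simps)
  finally have "int p ^ Suc i * v c = int p ^ Suc i * v (tower x i i) - int p ^ Suc i * (ram * int p ^ n * (m (Suc i) - m i))"
    by (simp only: right_diff_distrib)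
  also have "\<dots> = - (ram * (int b + int p ^ n * L (Suc i)))"
    unfolding X(2) L_Suc by (simp add: algebra_simps)
  finally show ?case
    using c_nz Suc.prems unfolding c_def k_def by (intro tower_valuation_step[OF x]) auto
qed

end

section \<open>The Galois action\<close>

text \<open>Dividing by the factorial removes the binomial coefficients, so automorphisms act by
  shifts whose coefficients depend on the shift alone. It is applied to digits k < p, where k! is
  invertible.\<close>

definition divided_power :: "'a::field \<Rightarrow> nat \<Rightarrow> 'a" where
  "divided_power y k = y ^ k / of_nat (fact k)"

lemma divided_power_add:
  fixes y z :: "'a::field"
  assumes "CHAR('a) = p" "p > 0" "k < p"
  shows "divided_power (y + z) k = (\<Sum>l\<le>k. divided_power z l * divided_power y (k - l))"
proof -
  have p: "prime p" using prime_CHAR_field[where 'a = 'a] assms by simp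
  have nz: "(of_nat (fact l) :: 'a) \<noteq> 0" if "l \<le> k" for l
    using that assms p by (simp add: of_nat_eq_0_iff_char_dvd prime_dvd_fact_iff)
  have "divided_power (y + z) k = (\<Sum>l\<le>k. of_nat (k choose l) * z ^ l * y ^ (k - l)) / of_nat (fact k)"
    unfolding divided_power_def by (subst add.commute) (simp add: binomial_ring)
  also have "\<dots> = (\<Sum>l\<le>k. divided_power z l * divided_power y (k - l))"
    unfolding sum_divide_distrib
  proof (intro sum.cong refl)
    fix l assume "l \<in> {..k}"
    then have l: "l \<le> k" by simp
    have "(of_nat (fact k) :: 'a) = of_nat (fact l) * of_nat (fact (k - l)) * of_nat (k choose l)"
      using binomial_fact_lemma[OF l] by (metis of_nat_mult)
    moreover have "(of_nat (fact k) :: 'a) \<noteq> 0" using nz by simp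
    ultimately show "of_nat (k choose l) * z ^ l * y ^ (k - l) / of_nat (fact k) = divided_power z l * divided_power y (k - l)"
      using nz[of l] nz[of "k - l"] l by (simp add: divided_power_def field_simps)
  qed
  finally show ?thesis .
qed

context valued_extension
begin

text \<open>Scalars from K change valuations by multiples of \<open>ram\<close>, so the nonzero
  terms of a relation have distinct valuations and cannot cancel.\<close>

lemma independent_distinct_valuations:
  assumes "finite J" "\<And>j. j \<in> J \<Longrightarrow> u j \<noteq> 0"
    and distinct: "\<And>i j. i \<in> J \<Longrightarrow> j \<in> J \<Longrightarrow> v (u i) mod ram = v (u j) mod ram \<Longrightarrow> i = j"
  shows "\<not> module.dependent (\<lambda>c y. \<iota> c * y) (u ` J)" "inj_on u J"
proof -
  interpret V: vector_space "\<lambda>c y. \<iota> c * y" by (rule vector_space)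
  show inj: "inj_on u J" using distinct by (auto intro!: inj_onI)
  show "V.independent (u ` J)"
  proof (rule V.independent_if_scalars_zero)
    fix g s assume *: "(\<Sum>s\<in>u ` J. \<iota> (g s) * s) = 0" "s \<in> u ` J"
    then obtain j where j: "j \<in> J" "s = u j" by auto
    have "(\<Sum>j\<in>J. \<iota> (g (u j)) * u j) = 0" using *(1) by (simp add: sum.reindex[OF inj])
    then have "\<iota> (g (u j)) * u j = 0"
    proof (rule sum_eq_0_terms[OF assms(1) _ j(1)])
      fix i j assume ij: "i \<in> J" "j \<in> J" "\<iota> (g (u i)) * u i \<noteq> 0" "\<iota> (g (u j)) * u j \<noteq> 0"
        "v (\<iota> (g (u i)) * u i) = v (\<iota> (g (u j)) * u j)"
      then have "ram * fls_subdegree (g (u i)) + v (u i) = ram * fls_subdegree (g (u j)) + v (u j)"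
        by (simp add: v_mult v_hom)
      then have "v (u i) = v (u j) + ram * (fls_subdegree (g (u j)) - fls_subdegree (g (u i)))"
        by (simp add: algebra_simps)
      then have "v (u i) mod ram = v (u j) mod ram" by simp
      then show "i = j" by (rule distinct[OF ij(1,2)])
    qed
    then show "g s = 0" using j assms(2) by auto
  qed (use assms in simp)
qed

end

section \<open>Total ramification and the adapted basis\<close>

locale near_one_dim_extension = near_one_dim_data \<iota> v p n b \<beta> \<Omega> \<epsilon>
  for \<iota> :: "'k::field fls \<Rightarrow> 'l::field" and v p n b \<beta> \<Omega> \<epsilon> +
  fixes x :: "nat \<Rightarrow> 'l"
  assumes x: "artin_schreier_roots x"
    and galois: "finite_galois_ext \<iota>"
    and degree: "ext_degree \<iota> = p ^ (n + 1)"
    and generated: "is_subfield hull (range \<iota> \<union> x ` {0..n}) = UNIV"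
begin

definition q :: nat where "q = p ^ (n + 1)"

lemma q_pos: "q > 0"
  using p_pos by (simp add: q_def)

lemma basis_ex: "\<exists>B. finite B \<and> card B = q \<and> \<not> module.dependent (\<lambda>c y. \<iota> c * y) B \<and>
    module.span (\<lambda>c y. \<iota> c * y) B = UNIV"
proof -
  interpret V: vector_space "\<lambda>c y. \<iota> c * y" by (rule vector_space)
  obtain B where B: "V.independent B" "UNIV \<subseteq> V.span B" "card B = V.dim UNIV"
    using V.basis_exists[of UNIV] by blast
  have "card B = q" using B(3) degree by (simp add: ext_degree_def q_def)
  \<comment> \<open>An infinite B would have cardinality 0, contrary to q > 0.\<close>
  then show ?thesis using B q_pos card_gt_0_iff[of B] by auto
qed

lemma independent_card_le:
  assumes "\<not> module.dependent (\<lambda>c y. \<iota> c * y) S"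
  shows "card S \<le> q"
proof -
  interpret V: vector_space "\<lambda>c y. \<iota> c * y" by (rule vector_space)
  obtain B where "finite B" "card B = q" "V.span B = UNIV" using basis_ex by auto
  then show ?thesis using V.independent_span_bound[of B S] assms by auto
qed

lemma independent_spans:
  assumes "\<not> module.dependent (\<lambda>c y. \<iota> c * y) S" "finite S" "card S = q"
  shows "module.span (\<lambda>c y. \<iota> c * y) S = UNIV"
proof (rule ccontr)
  interpret V: vector_space "\<lambda>c y. \<iota> c * y" by (rule vector_space)
  assume "V.span S \<noteq> UNIV"
  then obtain y where y: "y \<notin> V.span S" by auto
  then have "V.independent (insert y S)" using assms(1) by (intro V.independent_insertI)
  then have "card (insert y S) \<le> q" by (rule independent_card_le)
  moreover have "y \<notin> S" using y V.span_base by auto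
  ultimately show False using assms by simp
qed

lemma coprime_break: "coprime (int b + int p ^ n * L i) (int p)"
proof -
  obtain k where "L i = int p * k" using p_dvd_L by (metis dvdE)
  then have "int b + int p ^ n * L i = (int p ^ n * k) * int p + int b" by (simp add: ac_simps)
  then have "gcd (int p) (int b + int p ^ n * L i) = gcd (int p) (int b)" by (simp only: gcd_add_mult)
  moreover have "coprime (int p) (int b)" using coprime by (simp add: coprime_commute)
  ultimately have "coprime (int p) (int b + int p ^ n * L i)" by (simp only: coprime_iff_gcd_eq_1)
  then show ?thesis by (simp only: coprime_commute)
qed

lemma q_dvd_cancel: "int q dvd a * (int b + int p ^ n * L i) \<Longrightarrow> int q dvd a"
proof -
  have "coprime (int q) (int b + int p ^ n * L i)"
    unfolding q_def of_nat_power using coprime_break[of i] by (metis coprime_commute coprime_power_right_iff)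
  then show "int q dvd a * (int b + int p ^ n * L i) \<Longrightarrow> int q dvd a"
    by (simp add: coprime_dvd_mult_left_iff)
qed

text \<open>Elements of valuation 0, ..., ram - 1 are independent over K, so ram \<le> q. Conversely
  q times the valuation of \<open>tower x n n\<close> is - ram (b + p^n L_n), and the second factor
  is prime to p, so q divides ram.\<close>

lemma ram_eq: "ram = int q"
proof (rule antisym)
  have "\<exists>u. u \<noteq> 0 \<and> v u = k" for k
    using nv unfolding normalized_valuation_def by (metis (no_types, lifting) DiffD2 UNIV_I imageE insertI1)
  then obtain u where u: "\<And>k. u k \<noteq> 0" "\<And>k. v (u k) = k" by metis
  have *: "\<not> module.dependent (\<lambda>c y. \<iota> c * y) (u ` {0..<ram})" "inj_on u {0..<ram}"
    by (rule independent_distinct_valuations; simp add: u)+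
  have "card (u ` {0..<ram}) \<le> q" by (rule independent_card_le[OF *(1)])
  then show "ram \<le> int q" using card_image[OF *(2)] by simp
  have "int p ^ Suc n * v (tower x n n) = - (ram * (int b + int p ^ n * L n))"
    using tower_valuation[OF x order_refl] by simp
  then have "int q dvd ram * (int b + int p ^ n * L n)"
    unfolding q_def by (metis Suc_eq_plus1 dvd_minus_iff dvd_triv_left of_nat_power)
  then have "int q dvd ram" by (rule q_dvd_cancel)
  then show "int q \<le> ram" using ram_pos by (rule zdvd_imp_le)
qed

lemma v_tower:
  assumes "artin_schreier_roots y" "i \<le> n"
  shows "tower y i i \<noteq> 0" "v (tower y i i) = - (int p ^ (n - i) * (int b + int p ^ n * L i))"
proof -
  have "int q = int p ^ Suc i * int p ^ (n - i)"
    unfolding q_def using assms(2) by (simp flip: power_add power_Suc)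
  then have "int p ^ Suc i * v (tower y i i) = int p ^ Suc i * (- (int p ^ (n - i) * (int b + int p ^ n * L i)))"
    using tower_valuation[OF assms] by (simp add: ram_eq)
  then show "v (tower y i i) = - (int p ^ (n - i) * (int b + int p ^ n * L i))"
    using p_pos by (subst (asm) mult_left_cancel) auto
  show "tower y i i \<noteq> 0" using tower_valuation[OF assms] by simp
qed

text \<open>The index is reversed, so that \<open>X s\<close>, which is \<open>X\<^sub>n\<^sub>-\<^sub>s\<close> in the notation above, goes with digit \<open>s\<close>.\<close>

definition X :: "nat \<Rightarrow> 'l" where "X s = tower x (n - s) (n - s)"

definition e :: "nat \<Rightarrow> 'l" where
  "e j = (\<Prod>s\<le>n. divided_power (X s) (base_digit p j s))"

text \<open>The amount by which -v(e_j) exceeds b j, divided by q. The division by p is exact by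
  \<open>p_dvd_L\<close>, and additivity in the digits makes this term drop out of the final
  inequality.\<close>

definition \<Lambda> :: "nat \<Rightarrow> int" where
  "\<Lambda> j = (\<Sum>s\<le>n. int (base_digit p j s) * int p ^ s * (L (n - s) div int p))"

definition w :: "nat \<Rightarrow> int" where
  "w j = int b * int j + int q * \<Lambda> j"

lemma of_nat_fact:
  assumes "k < p"
  shows "(of_nat (fact k) :: 'l) \<noteq> 0" "v (of_nat (fact k)) = 0"
proof -
  show nz: "(of_nat (fact k) :: 'l) \<noteq> 0"
    using assms prime_p by (simp add: of_nat_eq_0_iff_char_dvd CHAR_L prime_dvd_fact_iff)
  then have "(of_nat (fact k) :: 'k fls) \<noteq> 0" using hom_of_nat[of "fact k"] hom_0 by metis
  then show "v (of_nat (fact k)) = 0"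
    using v_hom[of "of_nat (fact k)"] by simp
qed

lemma digit_less: "base_digit p j s < p"
  using p_pos by (rule base_digit_less)

lemma X_nz: "s \<le> n \<Longrightarrow> X s \<noteq> 0"
  and v_X: "s \<le> n \<Longrightarrow> v (X s) = - (int p ^ s * (int b + int p ^ n * L (n - s)))"
  using v_tower[OF x, of "n - s"] by (auto simp: X_def)

lemma e_nonzero: "e j \<noteq> 0"
  unfolding e_def using X_nz of_nat_fact[OF digit_less] by (auto simp: divided_power_def)

lemma v_e_eq:
  assumes "j < q"
  shows "v (e j) = - w j"
proof -
  have "v (e j) = (\<Sum>s\<le>n. int (base_digit p j s) * v (X s))"
    unfolding e_def using X_nz of_nat_fact[OF digit_less]
    by (subst v_prod) (auto simp: divided_power_def v_divide v_power intro!: sum.cong)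
  also have "\<dots> = (\<Sum>s\<le>n. - (int b * (int (base_digit p j s) * int p ^ s)
      + int q * (int (base_digit p j s) * int p ^ s * (L (n - s) div int p))))"
  proof (intro sum.cong refl)
    fix s assume "s \<in> {..n}"
    then have *: "v (X s) = - (int p ^ s * (int b + int p ^ n * (int p * (L (n - s) div int p))))"
      using v_X p_dvd_L by simp
    show "int (base_digit p j s) * v (X s) = - (int b * (int (base_digit p j s) * int p ^ s)
      + int q * (int (base_digit p j s) * int p ^ s * (L (n - s) div int p)))"
      unfolding * by (simp add: q_def algebra_simps)
  qed
  also have "\<dots> = - (int b * (\<Sum>s\<le>n. int (base_digit p j s) * int p ^ s) + int q * \<Lambda> j)"
    unfolding sum_negf sum.distrib sum_distrib_left[symmetric] \<Lambda>_def ..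
  also have "(\<Sum>s\<le>n. int (base_digit p j s) * int p ^ s) = int (\<Sum>s<n+1. base_digit p j s * p ^ s)"
    by (simp add: lessThan_Suc_atMost)
  also have "(\<Sum>s<n+1. base_digit p j s * p ^ s) = j"
    using digit_expansion[of j p "n+1"] assms by (simp only: q_def)
  finally show ?thesis by (simp only: w_def)
qed

lemma w_inject:
  assumes "i < q" "j < q" "w i mod int q = w j mod int q"
  shows "i = j"
proof -
  have "(int b * int i) mod int q = (int b * int j) mod int q" using assms(3) by (simp add: w_def)
  then have "[b * i = b * j] (mod q)"
    unfolding cong_def by (metis of_nat_eq_iff of_nat_mod of_nat_mult)
  moreover have "coprime b q" using coprime by (simp add: q_def)
  ultimately have "[i = j] (mod q)" by (simp add: cong_mult_lcancel_nat)
  then show ?thesis using assms by (intro cong_less_modulus_unique_nat)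
qed

text \<open>Valuations distinct modulo q make these q elements independent, hence a basis by
  degree.\<close>

lemma e_spanning: "\<exists>c. y = (\<Sum>j<q. \<iota> (c j) * e j)"
proof -
  interpret V: vector_space "\<lambda>c y. \<iota> c * y" by (rule vector_space)
  have distinct: "i = j" if "i \<in> {..<q}" "j \<in> {..<q}" "v (e i) mod ram = v (e j) mod ram" for i j
  proof (rule w_inject)
    have "(- w i) mod int q = (- w j) mod int q" using that by (simp add: v_e_eq ram_eq)
    then show "w i mod int q = w j mod int q" using mod_minus_cong by force
  qed (use that in auto)
  have indep: "V.independent (e ` {..<q})" and inj: "inj_on e {..<q}"
    by (rule independent_distinct_valuations; use distinct e_nonzero in simp)+
  have "V.span (e ` {..<q}) = UNIV"
    using indep card_image[OF inj] by (intro independent_spans) auto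
  then have "y \<in> V.span (e ` {..<q})" by simp
  then obtain g where "y = (\<Sum>s\<in>e ` {..<q}. \<iota> (g s) * s)"
    by (subst (asm) V.span_finite) auto
  then show ?thesis unfolding sum.reindex[OF inj] by auto
qed

section \<open>One automorphism acting on the basis\<close>

context
  fixes \<sigma> assumes \<sigma>: "\<sigma> \<in> galois_group \<iota>"
begin

interpretation \<sigma>: field_embedding \<sigma>
  using \<sigma> by (simp add: galois_group_def field_embedding_def)

lemma galois_fix: "\<sigma> (\<iota> c) = \<iota> c"
  using \<sigma> by (simp add: galois_group_def)

lemma galois_tower: "\<sigma> (tower x i j) = tower (\<lambda>i. \<sigma> (x i)) i j"
  by (induction i arbitrary: j) (auto simp: \<sigma>.hom_diff \<sigma>.hom_mult galois_fix)

lemma galois_roots: "artin_schreier_roots (\<lambda>i. \<sigma> (x i))"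
  using x unfolding artin_schreier_roots_def
  by (metis \<sigma>.hom_diff \<sigma>.hom_power galois_fix)

text \<open>Two roots of one equation differ by a solution of z^p = z, an element of the prime
  field.\<close>

lemma galois_root_diff:
  assumes "i \<le> n"
  shows "\<exists>c<p. \<sigma> (x i) = x i + of_nat c"
proof -
  define z where "z = \<sigma> (x i) - x i"
  have "\<sigma> (x i) ^ p - \<sigma> (x i) = x i ^ p - x i"
    using x galois_roots assms by (simp add: artin_schreier_roots_def)
  then have "z ^ p - z = 0"
    unfolding z_def frobenius_diff1[OF CHAR_L p_pos] by (simp add: algebra_simps)
  then have "(\<Prod>c<p. z - of_nat c) = 0"
    using artin_schreier_factorization[OF CHAR_L p_pos, of z 1] by simp
  then obtain c where "c < p" "z = of_nat c" by auto
  then show ?thesis by (auto simp: z_def algebra_simps)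
qed

text \<open>Tower elements are K-linear combinations of the x_i, each of which moves by an element
  of the prime field.\<close>

lemma galois_tower_diff:
  assumes "i \<le> j" "j \<le> n"
  shows "\<exists>c. \<sigma> (tower x i j) = tower x i j + \<iota> c"
  using assms
proof (induction i arbitrary: j)
  case 0
  then obtain c where "\<sigma> (x j) = x j + of_nat c" using galois_root_diff by blast
  then show ?case by (intro exI[of _ "of_nat c"]) simp
next
  case (Suc i)
  obtain c where c: "\<sigma> (tower x i j) = tower x i j + \<iota> c" using Suc by (metis Suc_leD)
  obtain c' where c': "\<sigma> (tower x i i) = tower x i i + \<iota> c'" using Suc by (metis Suc_leD order_refl order_trans)
  show ?case
    by (intro exI[of _ "c - (D i j / D i i) ^ p ^ (n - Suc i) * c'"])
      (simp add: \<sigma>.hom_diff \<sigma>.hom_mult galois_fix c c' hom_diff hom_mult algebra_simps)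
qed

text \<open>Each X_s is translated by some \<mu>_s in K. Expanding the product of divided powers of
  X_s + \<mu>_s gives one term for each a digitwise at most j, and its coefficient depends only on
  a.\<close>

lemma galois_e:
  "\<exists>c. \<forall>j<q. \<sigma> (e j) = (\<Sum>a | a \<le> j \<and> nocarry p n a (j - a). \<iota> (c a) * e (j - a))"
proof -
  have "\<exists>c. \<sigma> (X s) = X s + \<iota> c" for s
    unfolding X_def by (rule galois_tower_diff) auto
  then obtain \<mu> where \<mu>: "\<And>s. \<sigma> (X s) = X s + \<iota> (\<mu> s)" by metis
  define c where "c = (\<lambda>a. \<Prod>s\<le>n. divided_power (\<mu> s) (base_digit p a s))"
  have "\<sigma> (e j) = (\<Sum>a | a \<le> j \<and> nocarry p n a (j - a). \<iota> (c a) * e (j - a))" if j: "j < q" for j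
  proof -
    define B where "B = (\<lambda>s. {..base_digit p j s})"
    define F where "F = (\<lambda>s l. divided_power (\<iota> (\<mu> s)) l * divided_power (X s) (base_digit p j s - l))"
    have "\<sigma> (e j) = (\<Prod>s\<le>n. divided_power (\<sigma> (X s)) (base_digit p j s))"
      unfolding e_def by (simp add: \<sigma>.hom_prod divided_power_def \<sigma>.hom_divide \<sigma>.hom_power)
    also have "\<dots> = (\<Prod>s\<le>n. \<Sum>l\<in>B s. F s l)"
      unfolding \<mu> B_def F_def by (simp add: divided_power_add[OF CHAR_L p_pos digit_less])
    also have "\<dots> = (\<Sum>g\<in>PiE {..n} B. \<Prod>s\<le>n. F s (g s))"
      by (rule prod_sum_PiE) (auto simp: B_def)
    \<comment> \<open>Choosing an exponent up to the digit j_s in every factor amounts to choosing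
      the digits of a.\<close>
    also have "\<dots> = (\<Sum>a | a \<le> j \<and> nocarry p n a (j - a). \<iota> (c a) * e (j - a))"
    proof (rule sum.reindex_bij_witness[of _ "\<lambda>a. restrict (base_digit p a) {..n}" "\<lambda>g. \<Sum>s<n+1. g s * p ^ s"])
      fix g assume g: "g \<in> PiE {..n} B"
      define a where "a = (\<Sum>s<n+1. g s * p ^ s)"
      have gs: "g s \<le> base_digit p j s" if "s \<le> n" for s using g that by (auto simp: B_def)
      then have gp: "g s < p" if "s < n + 1" for s
        using that digit_less[of j s] by (metis Suc_eq_plus1 le_less_trans less_Suc_eq_le)
      have digit: "base_digit p a s = g s" if "s \<le> n" for s
        unfolding a_def using that by (intro base_digit_sum p_pos gp) auto
      have aq: "a < p ^ (n + 1)" unfolding a_def by (intro digit_sum_less p_pos gp)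
      have nd: "a \<le> j" "nocarry p n a (j - a)"
        using nocarry_diff[OF p_pos aq, of j] j gs digit by (auto simp: q_def)
      show "(\<Sum>s<n+1. g s * p ^ s) \<in> {a. a \<le> j \<and> nocarry p n a (j - a)}"
        unfolding a_def[symmetric] using nd by simp
      show "restrict (base_digit p (\<Sum>s<n+1. g s * p ^ s)) {..n} = g"
        unfolding a_def[symmetric] using g digit by (intro PiE_ext[of _ "{..n}" B]) auto
      have "base_digit p (j - a) s = base_digit p j s - g s" if "s \<le> n" for s
        using nocarry_add_digit[OF p_pos nd(2) that] nd(1) digit[OF that] by simp
      then have "\<iota> (c a) * e (j - a) = (\<Prod>s\<le>n. F s (g s))"
        unfolding c_def e_def hom_prod prod.distrib[symmetric] F_def using digit
        by (intro prod.cong) (auto simp: divided_power_def hom_divide hom_power)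
      then show "\<iota> (c (\<Sum>s<n+1. g s * p ^ s)) * e (j - (\<Sum>s<n+1. g s * p ^ s)) = (\<Prod>s\<le>n. F s (g s))"
        unfolding a_def .
    next
      fix a assume "a \<in> {a. a \<le> j \<and> nocarry p n a (j - a)}"
      then have a: "a \<le> j" "nocarry p n a (j - a)" by auto
      show "restrict (base_digit p a) {..n} \<in> PiE {..n} B"
        using nocarry_add_digit[OF p_pos a(2)] a(1) by (auto simp: B_def)
      have "a = (\<Sum>s<n+1. base_digit p a s * p ^ s)"
        using a(2) by (intro digit_expansion) (simp add: nocarry_def)
      also have "\<dots> = (\<Sum>s<n+1. restrict (base_digit p a) {..n} s * p ^ s)"
        by (intro sum.cong) auto
      finally show "(\<Sum>s<n+1. restrict (base_digit p a) {..n} s * p ^ s) = a" by simp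
    qed
    finally show ?thesis .
  qed
  then show ?thesis by blast
qed

end

section \<open>The order of the Galois group\<close>

lemma galois_determined:
  assumes "\<sigma> \<in> galois_group \<iota>" "\<tau> \<in> galois_group \<iota>" "\<And>i. i \<le> n \<Longrightarrow> \<sigma> (x i) = \<tau> (x i)"
  shows "\<sigma> = \<tau>"
proof -
  interpret \<sigma>: field_embedding \<sigma>
    using assms by (simp add: galois_group_def field_embedding_def)
  interpret \<tau>: field_embedding \<tau>
    using assms by (simp add: galois_group_def field_embedding_def)
  have "is_subfield hull (range \<iota> \<union> x ` {0..n}) \<subseteq> {y. \<sigma> y = \<tau> y}"
  proof (rule hull_minimal)
    show "range \<iota> \<union> x ` {0..n} \<subseteq> {y. \<sigma> y = \<tau> y}"
      using assms(3) galois_fix[OF assms(1)] galois_fix[OF assms(2)] by auto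
    show "is_subfield {y. \<sigma> y = \<tau> y}"
      by (simp add: is_subfield_def \<sigma>.hom_diff \<tau>.hom_diff \<sigma>.hom_mult \<tau>.hom_mult \<sigma>.hom_inverse \<tau>.hom_inverse)
  qed
  then show ?thesis using generated by auto
qed

lemma finite_galois: "finite (galois_group \<iota>)"
proof -
  define R where "R = (\<lambda>\<sigma>::'l \<Rightarrow> 'l. restrict (\<lambda>i. \<sigma> (x i)) {..n})"
  have "inj_on R (galois_group \<iota>)"
  proof (rule inj_onI)
    fix \<sigma> \<tau> assume *: "\<sigma> \<in> galois_group \<iota>" "\<tau> \<in> galois_group \<iota>" "R \<sigma> = R \<tau>"
    show "\<sigma> = \<tau>"
    proof (rule galois_determined[OF *(1,2)])
      fix i assume "i \<le> n"
      then show "\<sigma> (x i) = \<tau> (x i)" using fun_cong[OF *(3), of i] by (simp add: R_def)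
    qed
  qed
  moreover have "R ` galois_group \<iota> \<subseteq> PiE {..n} (\<lambda>i. (\<lambda>c. x i + of_nat c) ` {..<p})"
    using galois_root_diff by (force simp: R_def)
  moreover have "finite (PiE {..n} (\<lambda>i. (\<lambda>c. x i + of_nat c) ` {..<p}))"
    by (intro finite_PiE) auto
  ultimately show ?thesis by (meson finite_imageD finite_subset)
qed

text \<open>The norm of \<open>X 0\<close> lies in \<open>K\<close>, so its valuation is divisible by \<open>q\<close>; but it is \<open>|G|\<close> times
  an integer prime to \<open>p\<close>.\<close>

lemma card_galois: "card (galois_group \<iota>) \<ge> q"
proof -
  define G where "G = galois_group \<iota>"
  define N where "N = (\<Prod>\<sigma>\<in>G. \<sigma> (X 0))"
  have fin: "finite G" using finite_galois by (simp add: G_def)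
  \<comment> \<open>The conjugate roots satisfy the same equations, so \<open>v_tower\<close>
    applies to their tower and all conjugates of \<open>X 0\<close> have equal valuation.\<close>
  have v\<sigma>: "\<sigma> (X 0) \<noteq> 0" "v (\<sigma> (X 0)) = - (int b + int p ^ n * L n)" if "\<sigma> \<in> G" for \<sigma>
    using that galois_roots v_tower[of "\<lambda>i. \<sigma> (x i)" n] by (auto simp: G_def X_def galois_tower)
  have "\<tau> N = N" if \<tau>: "\<tau> \<in> G" for \<tau>
  proof -
    interpret \<tau>: field_embedding \<tau>
      using \<tau> by (simp add: G_def galois_group_def field_embedding_def)
    have "inj \<tau>" using \<tau> by (simp add: G_def galois_group_def bij_is_inj)
    have inj: "inj_on ((\<circ>) \<tau>) G"
    proof (intro inj_onI ext)
      fix \<sigma> \<sigma>' y assume "\<tau> \<circ> \<sigma> = \<tau> \<circ> \<sigma>'"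
      from fun_cong[OF this, of y] show "\<sigma> y = \<sigma>' y" using injD[OF \<open>inj \<tau>\<close>] by simp
    qed
    have "\<tau> \<circ> \<sigma> \<in> G" if "\<sigma> \<in> G" for \<sigma>
      using \<tau> that by (simp add: G_def galois_group_def bij_comp field_hom_def)
    then have "(\<circ>) \<tau> ` G \<subseteq> G" by blast
    then have im: "(\<circ>) \<tau> ` G = G" using inj fin by (intro endo_inj_surj)
    have "\<tau> N = (\<Prod>\<sigma>\<in>G. (\<tau> \<circ> \<sigma>) (X 0))" by (simp add: N_def \<tau>.hom_prod)
    also have "\<dots> = (\<Prod>\<sigma>\<in>(\<circ>) \<tau> ` G. \<sigma> (X 0))" by (simp add: prod.reindex[OF inj])
    finally show ?thesis by (simp add: im N_def)
  qed
  then have "N \<in> range \<iota>" using galois unfolding finite_galois_ext_def G_def by blast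
  then obtain z where z: "N = \<iota> z" by auto
  have "N \<noteq> 0" unfolding N_def using v\<sigma> fin by simp
  then have "v N = int q * fls_subdegree z" using z v_hom[of z] ram_eq by auto
  moreover have "v N = - (int (card G) * (int b + int p ^ n * L n))"
  proof -
    have "v N = (\<Sum>\<sigma>\<in>G. v (\<sigma> (X 0)))" unfolding N_def using v\<sigma>(1) by (rule v_prod)
    also have "\<dots> = (\<Sum>\<sigma>\<in>G. - (int b + int p ^ n * L n))" using v\<sigma>(2) by (rule sum.cong[OF refl])
    finally show ?thesis by (simp only: sum_constant mult_minus_right)
  qed
  ultimately have "int q dvd int (card G) * (int b + int p ^ n * L n)"
    by (metis dvd_minus_iff dvd_triv_left)
  then have "int q dvd int (card G)" by (rule q_dvd_cancel)
  moreover have "id \<in> G" by (simp add: G_def galois_group_def field_hom_def)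
  then have "card G > 0" using fin card_gt_0_iff by blast
  ultimately show ?thesis unfolding G_def by (simp add: dvd_imp_le)
qed

section \<open>Freeness in terms of the residue of b modulo q\<close>

sublocale shift_basis \<iota> v q e w "nocarry p n"
proof
  show "q > 0" by (rule q_pos)
  show "ram = int q" by (rule ram_eq)
  show "e j \<noteq> 0" for j by (rule e_nonzero)
  show "v (e j) = - w j" if "j < q" for j using that by (rule v_e_eq)
  show "i = j" if "i < q" "j < q" "w i mod int q = w j mod int q" for i j using that by (rule w_inject)
  show "\<exists>c. y = (\<Sum>j<q. \<iota> (c j) * e j)" for y by (rule e_spanning)
  show "a + i < q" if "nocarry p n a i" for a i
    unfolding q_def by (rule nocarry_add_less[OF p_pos that])
  show "nocarry p n (q - 1 - i) i" if "i < q" for i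
    using nocarry_complement[OF p_pos] that by (simp only: q_def)
  show "nocarry p n 0 i" if "i < q" for i
    using nocarry_0[OF p_pos] that by (simp only: q_def)
  show "finite (galois_group \<iota>)" by (rule finite_galois)
  show "q \<le> card (galois_group \<iota>)" by (rule card_galois)
  show "\<exists>c. \<forall>j<q. \<sigma> (e j) = (\<Sum>a | a \<le> j \<and> nocarry p n a (j - a). \<iota> (c a) * e (j - a))"
    if "\<sigma> \<in> galois_group \<iota>" for \<sigma> using that by (rule galois_e)
qed

text \<open>With b = q (b div q) + r, each \<open>d j\<close> is the ceiling of r j / q plus
  \<open>\<kappa> j\<close>. As \<kappa> is additive on pairs without carry, it cancels from the
  ceiling condition, leaving the inequality of \<open>ceiling_condition_iff_S_set\<close>.\<close>

theorem free_iff: "free_over_associated_order \<iota> v \<longleftrightarrow> b mod q \<in> S_set p n"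
proof -
  define r where "r = b mod q"
  define D' where "D' = (\<lambda>j::nat. - ((- (int r * int j)) div int q))"
  define \<kappa> where "\<kappa> = (\<lambda>j. int (b div q) * int j + \<Lambda> j)"
  have d_eq: "d j = D' j + \<kappa> j" for j
  proof -
    have "int b = int q * int (b div q) + int r"
      unfolding r_def by (metis div_mult_mod_eq mult.commute of_nat_add of_nat_mult)
    then have "- w j = - (int r * int j) + int q * (- \<kappa> j)"
      unfolding w_def \<kappa>_def by (simp only:) (simp add: algebra_simps)
    then have "(- w j) div int q = - \<kappa> j + (- (int r * int j)) div int q"
      using q_pos by (simp only: div_mult_self2)
    then show ?thesis by (simp add: d_def D'_def)
  qed
  have \<kappa>_add: "\<kappa> (a + i) = \<kappa> a + \<kappa> i" if "nocarry p n a i" for a i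
    unfolding \<kappa>_def \<Lambda>_def using nocarry_add_digit[OF p_pos that]
    by (simp add: algebra_simps sum.distrib)
  have iff: "d (q - 1) - d (q - 1 - a) \<le> d (a + i) - d i \<longleftrightarrow> D' (q - 1) - D' (q - 1 - a) \<le> D' (a + i) - D' i"
    if N: "nocarry p n a i" for a i
  proof -
    have aq: "a < q" using N_less[OF N] by simp
    then have "nocarry p n a (q - 1 - a)"
      using N_complement[of a] by (simp add: nocarry_commute)
    then have "\<kappa> (a + (q - 1 - a)) = \<kappa> a + \<kappa> (q - 1 - a)" by (rule \<kappa>_add)
    moreover have "a + (q - 1 - a) = q - 1" using aq by simp
    ultimately have "\<kappa> (q - 1) = \<kappa> a + \<kappa> (q - 1 - a)" by (simp only:)
    then show ?thesis unfolding d_eq using \<kappa>_add[OF N] by linarith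
  qed
  have q1: "q > 1" unfolding q_def using p_gt_1 by (intro one_less_power) auto
  have "coprime r p"
  proof -
    have "coprime b q" using coprime by (simp add: q_def)
    then have "coprime r q" using q_pos by (simp add: r_def coprime_mod_left_iff)
    then show ?thesis by (simp add: q_def)
  qed
  moreover have "r \<noteq> 0" using \<open>coprime r p\<close> p_gt_1 by (metis coprime_0_left_iff nat_dvd_1_iff_1 less_irrefl)
  moreover have "r < q" using q_pos by (simp add: r_def)
  ultimately have "(\<forall>a i. nocarry p n a i \<longrightarrow> D' (q - 1) - D' (q - 1 - a) \<le> D' (a + i) - D' i) \<longleftrightarrow> r \<in> S_set p n"
    unfolding D'_def q_def by (intro ceiling_condition_iff_S_set p_gt_1) auto
  moreover have "free_over_associated_order \<iota> v \<longleftrightarrow>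
      (\<forall>a i. nocarry p n a i \<longrightarrow> d (q - 1) - d (q - 1 - a) \<le> d (a + i) - d i)"
    using free_if_ceiling_condition ceiling_condition_if_free by blast
  ultimately show ?thesis using iff by (simp add: r_def)
qed

end

theorem theorem1p1:
  fixes \<iota> :: "'k::field fls \<Rightarrow> 'l::field"
    and v :: "'l \<Rightarrow> int"
    and p n b :: nat
    and \<beta> :: "'k fls"
    and \<Omega> \<epsilon> :: "nat \<Rightarrow> 'k fls"
    and x :: "nat \<Rightarrow> 'l"
  assumes char: "CHAR('k) = p" "p > 0"
    and perfect: "surj (\<lambda>a::'k. a ^ p)"
    and extension: "field_hom \<iota>"
    and valuation: "normalized_valuation \<iota> v"
    and near_one_dim: "near_one_dim_ext p n \<iota> \<beta> b \<Omega> \<epsilon> x"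
  shows "free_over_associated_order \<iota> v \<longleftrightarrow> b mod p ^ (n + 1) \<in> S_set p n"
proof -
  note ext = near_one_dim[unfolded near_one_dim_ext_def]
  note ext5 = ext[THEN conjunct2, THEN conjunct2, THEN conjunct2, THEN conjunct2]
  note ext10 = ext5[THEN conjunct2, THEN conjunct2, THEN conjunct2, THEN conjunct2, THEN conjunct2, THEN conjunct2]
  interpret near_one_dim_data \<iota> v p n b \<beta> \<Omega> \<epsilon>
  proof
    show "field_hom \<iota>" "normalized_valuation \<iota> v" "CHAR('k) = p" "p > 0" by fact+
    show "fls_subdegree \<beta> = - int b" "b > 0" "coprime b p" "\<Omega> 0 = 1" using ext5 by simp_all
    show "\<Omega> i \<noteq> 0" if "i \<le> n" for i using ext5 that by simp
    show "fls_subdegree (\<Omega> (Suc i)) \<le> fls_subdegree (\<Omega> i)" if "i < n" for i using ext5 that by simp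
    show "\<forall>s\<in>{i..j}. int p dvd a s"
      if "i < j" "j \<le> n" "\<forall>s\<in>{i..j}. fls_subdegree (\<Omega> s) = fls_subdegree (\<Omega> i)"
        "(\<Sum>s=i..j. of_int (a s) * \<Omega> s) \<in> (\<lambda>z. \<Omega> i * z) ` maximal_ideal fls_subdegree" for i j a
      using that by (rule ext10[THEN conjunct1, THEN spec, THEN spec, THEN mp, THEN mp, THEN mp, THEN spec, THEN mp])
    show "real_of_int (fls_subdegree (\<epsilon> i)) > real_of_int (fls_subdegree (\<Omega> i ^ (p ^ n) * \<beta>))
        + (real p ^ n - 1) * real b / real p ^ n
        - (real p - 1) * (\<Sum>j=1..<n. real p ^ j * real_of_int (fls_subdegree (\<Omega> j)))"
      if "i \<le> n" "\<epsilon> i \<noteq> 0" for i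
      using that by (rule ext10[THEN conjunct2, THEN spec, THEN mp, THEN mp])
  qed
  interpret near_one_dim_extension \<iota> v p n b \<beta> \<Omega> \<epsilon> x
  proof
    show "artin_schreier_roots x" unfolding artin_schreier_roots_def using ext by (elim conjE)
    show "finite_galois_ext \<iota>" using ext by (simp only: elementary_abelian_ext_def)
    show "ext_degree \<iota> = p ^ (n + 1)" "is_subfield hull (range \<iota> \<union> x ` {0..n}) = UNIV"
      using ext by (simp_all only:)
  qed
  show ?thesis using free_iff by (simp only: q_def)
qed

end
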